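(* Assume $m_j>n_j+1$ for some $j\in\{1,\dots,M\}$. Furthermore, assume that one of the following conditions is fulfilled: \begin{enumerate} \item $m_k>1$ for all $k$. \item $m_k\ge 1$ for all $k$, $m_i=1$ for some $i$, and $\sum_{k:\,m_k=1}\lambda_k r_k(t)e^{C}<b(t)$ for all $t$. \item $m_i<1$ for some $i$, and there is a constant $\gamma_1\in\mathbb{R}$ such that $\sum_{k=1}^{M}\lambda_k r_k(t)\frac{e^{(m_k-1)\gamma_1}e^{m_kC}}{1+e^{n_k\gamma_1}}<b(t)$ for all $t$. \end{enumerate} Then the equation $$x'(t)=\sum_{k=1}^{M}\lambda_k r_k(t)\frac{x^{m_k}(t-\tau_k(t))}{1+x^{n_k}(t-\mu_k(t))}-b(t)x(t)$$ admits at least one positive $T$-periodic solution.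
   Context: Let $T>0$ and let $M\ge 1$ be an integer. For $k=1,\dots,M$, let $\lambda_k,m_k,n_k$ be positive real constants, and let $r_k,\tau_k,\mu_k$ and $b$ be continuous, positive, $T$-periodic functions $\mathbb{R}\to\mathbb{R}$. Set $C:=\int_0^T b(t)\,dt$. Here $x^{m}(s)$ means $(x(s))^{m}$. A positive $T$-periodic solution is a $T$-periodic differentiable function $x:\mathbb{R}\to(0,\infty)$ satisfying the equation for all $t\in\mathbb{R}$. *)

theory Defs
  imports "HOL-Analysis.Analysis" "HOL-Library.Periodic_Fun"
begin

end

theory Submission
  imports Defs "HOL-Complex_Analysis.Great_Picard"
begin

text \<open>
  Let \<open>A y\<close> be the \<open>T\<close>-periodic solution of \<open>x' = F y - b x\<close>, where \<open>F y\<close> is the delayed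
  production term. Every \<open>A y\<close> satisfies \<open>max \<le> e\<^sup>C min\<close>. The hypotheses say that production is too
  weak to balance \<open>b x\<close> when \<open>min x = L\<close> for a suitable \<open>L\<close> (\<open>L = e\<^sup>\<gamma>\<close> in the third case, any small
  \<open>L\<close> in the other two), while \<open>m\<^sub>j > n\<^sub>j + 1\<close> makes it too strong when \<open>min x = U\<close> with \<open>U\<close> large.
  This is an expansive situation, so \<open>A\<close> itself need not preserve a bounded set. One therefore
  rescales \<open>A y\<close> so that its minimum becomes \<open>(min y)\<^sup>2 / min (A y)\<close>, clamped to \<open>[L, U]\<close>. The
  rescaled map preserves the order interval of functions with values in \<open>[L, e\<^sup>C U]\<close>, and at a fixed
  point \<open>y = q A y\<close> the clamp can only be active if \<open>y\<close> is strictly monotone; hence \<open>q = 1\<close>.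
  The fixed point exists because finite-dimensional sections given by partitions of unity have
  approximate fixed points by Kuhn's combinatorial lemma, and these converge along a subsequence by
  the theorem of Arzela and Ascoli.
\<close>

section \<open>Fixed points in order intervals of periodic functions\<close>

text \<open>Grid points are labelled by the sign of \<open>f - id\<close> in each coordinate. Kuhn's
  lemma finds one small cell on which every coordinate of \<open>f - id\<close> changes sign, and by
  uniform continuity each coordinate is small at the corner of that cell. Points are functions on
  \<open>nat\<close> of which only the first \<open>n\<close> values count, because the dimension
  later depends on the accuracy wanted.\<close>

lemma approx_brouwer_cube:
  fixes f :: "(nat \<Rightarrow> real) \<Rightarrow> nat \<Rightarrow> real"
  assumes maps: "\<And>z i. \<lbrakk>\<forall>j<n. z j \<in> {0..1}; i < n\<rbrakk> \<Longrightarrow> f z i \<in> {0..1}"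
    and uc: "\<And>e. e > 0 \<Longrightarrow> \<exists>d>0. \<forall>z z'. (\<forall>j<n. z j \<in> {0..1}) \<longrightarrow> (\<forall>j<n. z' j \<in> {0..1}) \<longrightarrow>
               (\<forall>j<n. \<bar>z j - z' j\<bar> \<le> d) \<longrightarrow> (\<forall>i<n. \<bar>f z i - f z' i\<bar> \<le> e)"
    and "e > 0"
  obtains z where "\<forall>j<n. z j \<in> {0..1}" "\<forall>i<n. \<bar>f z i - z i\<bar> \<le> e"
proof -
  obtain d where "d > 0" and d: "\<And>z z' i. \<lbrakk>\<forall>j<n. z j \<in> {0..1}; \<forall>j<n. z' j \<in> {0..1};
      \<forall>j<n. \<bar>z j - z' j\<bar> \<le> d; i < n\<rbrakk> \<Longrightarrow> \<bar>f z i - f z' i\<bar> \<le> e/2"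
    using uc[of "e/2"] \<open>e > 0\<close> by auto
  \<comment> \<open>A mesh below \<open>d\<close> lets \<open>f\<close> vary by at most
    \<open>e/2\<close> from the corner of a cell, and a mesh below \<open>e/2\<close> does the same
    for the coordinates themselves; together they give \<open>e\<close>.\<close>
  obtain p :: nat where "p > 0" and p: "1 / p < min d (e/2)"
    using real_arch_invD[of "min d (e/2)"] \<open>d > 0\<close> \<open>e > 0\<close>
    by (metis divide_pos_pos gr0I inverse_eq_divide min_less_iff_conj zero_less_numeral)
  define v where "v x = (\<lambda>i. real (x i) / real p)" for x :: "nat \<Rightarrow> nat"
  have v_cube: "\<forall>j<n. v x j \<in> {0..1}" if "\<forall>j<n. x j \<le> p" for x
    using that \<open>p > 0\<close> by (auto simp: v_def)
  \<comment> \<open>The clause \<open>x i < p\<close> forces label 1 on the upper faces, where \<open>f\<close> might fix the coordinate.\<close>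
  define label where "label x i = (if f (v x) i \<ge> v x i \<and> x i < p then 0 else 1::nat)" for x i
  obtain q where q: "\<forall>i<n. q i < p"
    and rs: "\<forall>i<n. \<exists>r s. (\<forall>j<n. q j \<le> r j \<and> r j \<le> q j + 1) \<and>
                  (\<forall>j<n. q j \<le> s j \<and> s j \<le> q j + 1) \<and> label r i \<noteq> label s i"
  proof (rule kuhn_lemma[of p n label])
    show "\<forall>x. (\<forall>i<n. x i \<le> p) \<longrightarrow> (\<forall>i<n. x i = 0 \<longrightarrow> label x i = 0)"
      using maps[OF v_cube] \<open>p > 0\<close> by (auto simp: label_def v_def)
  qed (auto simp: label_def \<open>p > 0\<close>)
  have near: "\<bar>f (v q) i - f (v r) i\<bar> \<le> e/2 \<and> v q i \<le> v r i \<and> v r i \<le> v q i + e/2 \<and> f (v r) i \<le> 1"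
    if r: "\<forall>j<n. q j \<le> r j \<and> r j \<le> q j + 1" and "i < n" for r i
  proof -
    have rp: "\<forall>j<n. r j \<le> p" and qp: "\<forall>j<n. q j \<le> p"
      using r q by (auto simp: Suc_le_eq intro: order_trans)
    have *: "v q j \<le> v r j \<and> v r j \<le> v q j + 1/p" if "j < n" for j
    proof -
      have "q j \<le> r j" "r j \<le> q j + 1" using r that by auto
      then have "real (q j) \<le> r j" "real (r j) \<le> q j + 1" by linarith+
      then show ?thesis using \<open>p > 0\<close> by (auto simp: v_def field_simps)
    qed
    have "\<forall>j<n. \<bar>v q j - v r j\<bar> \<le> d"
      using * p by (smt (verit))
    from d[OF v_cube[OF qp] v_cube[OF rp] this \<open>i < n\<close>] *[OF \<open>i < n\<close>] p maps[OF v_cube[OF rp] \<open>i < n\<close>]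
    show ?thesis by auto
  qed
  have key: "\<bar>f (v q) i - v q i\<bar> \<le> e" if "i < n" for i
  proof -
    obtain r' s' where *: "\<forall>j<n. q j \<le> r' j \<and> r' j \<le> q j + 1" "\<forall>j<n. q j \<le> s' j \<and> s' j \<le> q j + 1"
      "label r' i \<noteq> label s' i"
      using rs \<open>i < n\<close> by blast
    have "(label r' i = 0 \<and> label s' i = 1) \<or> (label r' i = 1 \<and> label s' i = 0)"
      using *(3) by (auto simp: label_def split: if_splits)
    with * obtain r s where r: "\<forall>j<n. q j \<le> r j \<and> r j \<le> q j + 1" and s: "\<forall>j<n. q j \<le> s j \<and> s j \<le> q j + 1"
      and "label r i = 0" "label s i = 1"
      by metis
    then have "f (v r) i \<ge> v r i" "f (v s) i \<le> v s i \<or> s i \<ge> p"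
      by (auto simp: label_def split: if_splits)
    \<comment> \<open>On the upper face label 1 says nothing about \<open>f\<close>, but there
      \<open>v s i \<ge> 1 \<ge> f (v s) i\<close>, so the sign change survives.\<close>
    moreover have "v s i \<ge> 1" if "s i \<ge> p"
      using that \<open>p > 0\<close> by (auto simp: v_def)
    ultimately show ?thesis
      using near[OF r \<open>i < n\<close>] near[OF s \<open>i < n\<close>] by argo
  qed
  have "\<forall>j<n. q j \<le> p" using q by (simp add: less_imp_le)
  with key v_cube show ?thesis by (intro that[of "v q"]) auto
qed

section \<open>Periodic partitions of unity\<close>

lemma periodic_reduce:
  fixes T t :: real
  assumes "T > 0"
  obtains k :: int where "a \<le> t + of_int k * T" "t + of_int k * T < a + T"
proof
  define k where "k = \<lfloor>(t - a)/T\<rfloor>"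
  have "of_int k \<le> (t - a)/T" "(t - a)/T < of_int k + 1" unfolding k_def by linarith+
  then show "a \<le> t + of_int (-k) * T" "t + of_int (-k) * T < a + T"
    using assms by (simp_all add: field_simps)
qed

lemma periodic_shift:
  assumes "periodic_fun_simple f T"
  shows "f (t + of_int k * T) = f t"
proof -
  interpret periodic_fun_simple f T by fact
  show ?thesis by (rule plus_of_int)
qed

text \<open>Tent functions of the distance from \<open>t - p i\<close> to the lattice of multiples
  of \<open>T\<close>, divided by their sum. Measuring the distance to the lattice makes them
  periodic, and a spacing of the nodes below \<open>h\<close> keeps the sum positive.\<close>

lemma periodic_partition_of_unity:
  fixes T h :: real
  assumes "T > 0" "h > 0"
  obtains n :: nat and \<phi> :: "nat \<Rightarrow> real \<Rightarrow> real" and p :: "nat \<Rightarrow> real"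
  where "\<And>i. continuous_on UNIV (\<phi> i)" "\<And>i. periodic_fun_simple (\<phi> i) T" "\<And>i t. \<phi> i t \<ge> 0"
    "\<And>t. (\<Sum>i<n. \<phi> i t) = 1"
    "\<And>i t. \<phi> i t \<noteq> 0 \<Longrightarrow> \<exists>k::int. \<bar>t - p i + of_int k * T\<bar> < h"
proof -
  define A where "A = range (\<lambda>k::int. of_int k * T)"
  have AT: "a + of_int j * T \<in> A" if aA: "a \<in> A" for a and j :: int
  proof -
    obtain k :: int where "a = of_int k * T" using aA by (auto simp: A_def)
    then have "a + of_int j * T = of_int (k + j) * T" by (simp add: algebra_simps)
    then show ?thesis unfolding A_def by blast
  qed
  have "A \<noteq> {}" by (simp add: A_def)
  \<comment> \<open>One inequality for every integer shift suffices: the shift by \<open>-1\<close>,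
    taken at \<open>x + T\<close>, is the reverse inequality.\<close>
  have le: "infdist (x + of_int j * T) A \<le> infdist x A" for x and j :: int
    unfolding infdist_notempty[OF \<open>A \<noteq> {}\<close>, of x]
  proof (rule cINF_greatest[OF \<open>A \<noteq> {}\<close>])
    fix a assume "a \<in> A"
    from infdist_le[OF AT[OF this, of j], of "x + of_int j * T"]
    show "infdist (x + of_int j * T) A \<le> dist x a" by (simp add: dist_real_def)
  qed
  have per: "infdist (x + T) A = infdist x A" for x
    using le[of x 1] le[of "x + T" "-1"] by simp
  obtain n :: nat where n: "n > 0" "T / n < h"
    using reals_Archimedean2[of "T / h"] assms
    by (metis divide_less_eq divide_pos_pos gr0I mult.commute not_less_iff_gr_or_eq of_nat_0 order.strict_trans)
  define p where "p i = real i * (T / n)" for i :: nat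
  define \<psi> where "\<psi> i t = max 0 (h - infdist (t - p i) A)" for i t
  have pos: "(\<Sum>i<n. \<psi> i t) > 0" for t
  proof -
    obtain k :: int where k: "0 \<le> t + of_int k * T" "t + of_int k * T < 0 + T"
      using periodic_reduce[OF \<open>T > 0\<close>] .
    define u where "u = t + of_int k * T"
    \<comment> \<open>\<open>p i\<close> is the last node at or below the representative
      \<open>u\<close> of \<open>t\<close> in \<open>[0, T)\<close>, hence within
      \<open>T / n < h\<close> of \<open>u\<close>.\<close>
    define i where "i = nat \<lfloor>u / (T/n)\<rfloor>"
    have "u / (T/n) \<ge> 0" using k n \<open>T > 0\<close> by (auto simp: u_def)
    then have i: "real i \<le> u / (T/n)" "u / (T/n) < real i + 1"
      unfolding i_def by linarith+
    moreover have "u / (T/n) < n"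
    proof -
      have "u * n < T * n" using k n by (intro mult_strict_right_mono) (auto simp: u_def)
      then show ?thesis using n \<open>T > 0\<close> by (simp add: field_simps)
    qed
    ultimately have "i < n" by linarith
    have "0 \<le> u - p i" "u - p i < T / n"
      using i n \<open>T > 0\<close> pos_le_divide_eq[of "T / n" "real i" u] pos_divide_less_eq[of "T / n" u "real i + 1"]
      by (auto simp: p_def algebra_simps add_divide_distrib)
    have "infdist (t - p i) A \<le> dist (t - p i) (0 + of_int (-k) * T)"
      by (rule infdist_le) (rule AT, auto simp: A_def)
    also have "\<dots> < h"
      using \<open>0 \<le> u - p i\<close> \<open>u - p i < T / n\<close> n by (simp add: dist_real_def u_def)
    finally have "\<psi> i t > 0" by (simp add: \<psi>_def)
    then show ?thesis using \<open>i < n\<close>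
      by (intro sum_pos2[of _ i]) (auto simp: \<psi>_def)
  qed
  have cont: "continuous_on UNIV (\<psi> i)" for i
    unfolding \<psi>_def by (intro continuous_intros)
  have \<psi>per: "\<psi> i (t + T) = \<psi> i t" for i t
    using per[of "t - p i"] by (simp add: \<psi>_def algebra_simps)
  show ?thesis
  proof
    show "continuous_on UNIV (\<lambda>t. \<psi> i t / (\<Sum>i<n. \<psi> i t))" for i
      using pos cont by (intro continuous_intros) (auto simp: less_imp_neq[symmetric] dest: less_imp_neq)
    show "periodic_fun_simple (\<lambda>t. \<psi> i t / (\<Sum>i<n. \<psi> i t)) T" for i
      by standard (simp add: \<psi>per)
    show "\<psi> i t / (\<Sum>i<n. \<psi> i t) \<ge> 0" for i t
      using pos[of t] by (auto simp: \<psi>_def intro!: divide_nonneg_nonneg)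
    show "(\<Sum>i<n. \<psi> i t / (\<Sum>i<n. \<psi> i t)) = 1" for t
      using pos[of t] by (simp flip: sum_divide_distrib)
    show "\<exists>k::int. \<bar>t - p i + of_int k * T\<bar> < h" if "\<psi> i t / (\<Sum>i<n. \<psi> i t) \<noteq> 0" for i t
    proof -
      have "infdist (t - p i) A < h" using that by (auto simp: \<psi>_def max_def split: if_splits)
      then obtain a where "a \<in> A" "dist (t - p i) a < h"
        unfolding infdist_notempty[OF \<open>A \<noteq> {}\<close>] by (subst (asm) cINF_less_iff) (auto simp: \<open>A \<noteq> {}\<close> intro!: bdd_belowI[of _ 0])
      then obtain k :: int where "\<bar>t - p i - of_int k * T\<bar> < h"
        by (auto simp: A_def dist_real_def)
      then show ?thesis by (intro exI[of _ "-k"]) simp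
    qed
  qed
qed

section \<open>Fixed points of Lipschitz-valued operators on a box of periodic functions\<close>

definition periodic_box :: "real \<Rightarrow> real \<Rightarrow> real \<Rightarrow> (real \<Rightarrow> real) set" where
  "periodic_box T L R = {y. continuous_on UNIV y \<and> periodic_fun_simple y T \<and> (\<forall>t. L \<le> y t \<and> y t \<le> R)}"

text \<open>Uniform continuity for the supremum norm, expressed by pointwise bounds. The premise
  ranges over all \<open>t\<close> at once because the operators are nonlocal.\<close>

definition sup_uniformly_continuous_on ::
    "(real \<Rightarrow> real) set \<Rightarrow> ((real \<Rightarrow> real) \<Rightarrow> real \<Rightarrow> real) \<Rightarrow> bool" where
  "sup_uniformly_continuous_on S \<Phi> \<longleftrightarrow>
     (\<forall>e>0. \<exists>d>0. \<forall>y\<in>S. \<forall>y'\<in>S. (\<forall>t. \<bar>y t - y' t\<bar> \<le> d) \<longrightarrow> (\<forall>t. \<bar>\<Phi> y t - \<Phi> y' t\<bar> \<le> e))"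

lemma sup_uniformly_continuous_onD:
  assumes "sup_uniformly_continuous_on S \<Phi>" "e > 0"
  obtains d where "d > 0"
    "\<And>y y' t. \<lbrakk>y \<in> S; y' \<in> S; \<And>t. \<bar>y t - y' t\<bar> \<le> d\<rbrakk> \<Longrightarrow> \<bar>\<Phi> y t - \<Phi> y' t\<bar> \<le> e"
  using assms unfolding sup_uniformly_continuous_on_def by meson

text \<open>Indices of weight zero are exempt from the bound: in a partition of unity only nodes
  near \<open>t\<close> carry weight at \<open>t\<close>, and only there is \<open>a i\<close> under
  control.\<close>

lemma convex_combination_bounds:
  fixes w a :: "nat \<Rightarrow> real"
  assumes "\<And>i. w i \<ge> 0" "(\<Sum>i<n. w i) = 1" "\<And>i. \<lbrakk>i < n; w i \<noteq> 0\<rbrakk> \<Longrightarrow> L \<le> a i \<and> a i \<le> R"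
  shows "L \<le> (\<Sum>i<n. a i * w i) \<and> (\<Sum>i<n. a i * w i) \<le> R"
proof -
  have "L * w i \<le> a i * w i \<and> a i * w i \<le> R * w i" if "i < n" for i
    using assms(1)[of i] assms(3)[OF that] by (cases "w i = 0") (auto intro!: mult_right_mono)
  then have "(\<Sum>i<n. L * w i) \<le> (\<Sum>i<n. a i * w i) \<and> (\<Sum>i<n. a i * w i) \<le> (\<Sum>i<n. R * w i)"
    by (auto intro!: sum_mono)
  then show ?thesis using assms(2) by (simp flip: sum_distrib_left)
qed

lemma convex_combination_abs:
  fixes w a :: "nat \<Rightarrow> real"
  assumes "\<And>i. w i \<ge> 0" "(\<Sum>i<n. w i) = 1" "\<And>i. \<lbrakk>i < n; w i \<noteq> 0\<rbrakk> \<Longrightarrow> \<bar>a i\<bar> \<le> d"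
  shows "\<bar>\<Sum>i<n. a i * w i\<bar> \<le> d"
proof -
  have "- d \<le> a i \<and> a i \<le> d" if "i < n" "w i \<noteq> 0" for i
    using assms(3)[OF that] by (simp add: abs_le_iff)
  then have "- d \<le> (\<Sum>i<n. a i * w i) \<and> (\<Sum>i<n. a i * w i) \<le> d"
    by (intro convex_combination_bounds assms)
  then show ?thesis by (simp add: abs_le_iff)
qed

text \<open>Coefficients of a partition of unity map a cube into the box, and sampling
  \<open>\<Phi>\<close> at the nodes turns the operator into a self-map of the cube. An approximate
  fixed point there brings the coefficients of \<open>E z\<close> close to the node values of
  \<open>\<Phi> (E z)\<close>; the common Lipschitz bound on the images extends this to every
  \<open>t\<close>.\<close>

lemma periodic_box_approx_fixed_point:
  assumes "T > 0" "L < R" "e > 0"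
    and maps: "\<And>y. y \<in> periodic_box T L R \<Longrightarrow> \<Phi> y \<in> periodic_box T L R"
    and uc: "sup_uniformly_continuous_on (periodic_box T L R) \<Phi>"
    and lip: "\<And>y s t. y \<in> periodic_box T L R \<Longrightarrow> \<bar>\<Phi> y s - \<Phi> y t\<bar> \<le> c * \<bar>s - t\<bar>"
  shows "\<exists>y\<in>periodic_box T L R. \<forall>t. \<bar>\<Phi> y t - y t\<bar> \<le> e"
proof -
  \<comment> \<open>Half of \<open>e\<close> pays for the variation of \<open>\<Phi> (E z)\<close>
    over a distance \<open>h\<close>, the other half for the error on the cube. The
    \<open>+ 1\<close> covers \<open>c = 0\<close>.\<close>
  define h where "h = e / 2 / (\<bar>c\<bar> + 1)"
  have "h > 0" and ch: "\<bar>c\<bar> * h \<le> e / 2"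
    using \<open>e > 0\<close> by (auto simp: h_def field_simps)
  obtain n :: nat and \<phi> p where \<phi>: "\<And>i. continuous_on UNIV (\<phi> i)" "\<And>i. periodic_fun_simple (\<phi> i) T"
      "\<And>i t. \<phi> i t \<ge> (0::real)" "\<And>t. (\<Sum>i<n. \<phi> i t) = 1"
    and near: "\<And>i t. \<phi> i t \<noteq> 0 \<Longrightarrow> \<exists>k::int. \<bar>t - p i + of_int k * T\<bar> < h"
    by (rule periodic_partition_of_unity[OF \<open>T > 0\<close> \<open>h > 0\<close>]) (rule that)
  define E where "E z t = (\<Sum>i<n. (L + (R - L) * z i) * \<phi> i t)" for z t
  define f where "f z i = (\<Phi> (E z) (p i) - L) / (R - L)" for z i
  have E: "E z \<in> periodic_box T L R" if "\<forall>j<n. z j \<in> {0..1}" for z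
    unfolding periodic_box_def
  proof (intro CollectI conjI allI)
    show "continuous_on UNIV (E z)"
      unfolding E_def by (intro continuous_intros \<phi>)
    show "periodic_fun_simple (E z) T"
      by standard (simp add: E_def periodic_fun_simple.plus_period[OF \<phi>(2)])
    have "L \<le> L + (R - L) * z i \<and> L + (R - L) * z i \<le> R" if "i < n" for i
    proof -
      have "0 \<le> z i" "z i \<le> 1" using \<open>\<forall>j<n. z j \<in> {0..1}\<close> that by auto
      then have "0 \<le> (R - L) * z i" "(R - L) * z i \<le> R - L"
        using \<open>L < R\<close> by (auto intro: mult_left_le)
      then show ?thesis by linarith
    qed
    then show "L \<le> E z t" "E z t \<le> R" for t
      unfolding E_def using convex_combination_bounds[of "\<lambda>i. \<phi> i t" n L "\<lambda>i. L + (R - L) * z i" R] \<phi>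
      by auto
  qed
  obtain z where z: "\<forall>j<n. z j \<in> {0..1}" "\<forall>i<n. \<bar>f z i - z i\<bar> \<le> e / 2 / (R - L)"
  proof (rule approx_brouwer_cube[of n f "e / 2 / (R - L)"])
    show "f z i \<in> {0..1}" if "\<forall>j<n. z j \<in> {0..1}" "i < n" for z i
      using maps[OF E[OF that(1)]] \<open>L < R\<close> by (auto simp: f_def periodic_box_def field_simps)
  next
    fix \<epsilon> :: real assume "\<epsilon> > 0"
    then have "\<epsilon> * (R - L) > 0" using \<open>L < R\<close> by simp
    from sup_uniformly_continuous_onD[OF uc this] obtain d where "d > 0"
      and d: "\<And>y y' t. \<lbrakk>y \<in> periodic_box T L R; y' \<in> periodic_box T L R; \<And>t. \<bar>y t - y' t\<bar> \<le> d\<rbrakk>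
                \<Longrightarrow> \<bar>\<Phi> y t - \<Phi> y' t\<bar> \<le> \<epsilon> * (R - L)" by metis
    show "\<exists>d>0. \<forall>z z'. (\<forall>j<n. z j \<in> {0..1}) \<longrightarrow> (\<forall>j<n. z' j \<in> {0..1}) \<longrightarrow>
               (\<forall>j<n. \<bar>z j - z' j\<bar> \<le> d) \<longrightarrow> (\<forall>i<n. \<bar>f z i - f z' i\<bar> \<le> \<epsilon>)"
    proof (intro exI[of _ "d / (R - L)"] conjI allI impI)
      fix z z' i
      assume z: "\<forall>j<n. z j \<in> {0..1}" "\<forall>j<n. z' j \<in> {0..1}" "\<forall>j<n. \<bar>z j - z' j\<bar> \<le> d / (R - L)" "i < n"
      have "\<bar>E z t - E z' t\<bar> \<le> d" for t
      proof -
        have *: "E z t - E z' t = (\<Sum>i<n. ((R - L) * (z i - z' i)) * \<phi> i t)"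
          unfolding E_def sum_subtractf[symmetric] by (simp add: algebra_simps)
        have "\<bar>(R - L) * (z i - z' i)\<bar> \<le> d" if "i < n" for i
        proof -
          have "(R - L) * \<bar>z i - z' i\<bar> \<le> (R - L) * (d / (R - L))"
            using z(3) that \<open>L < R\<close> by (intro mult_left_mono) auto
          then show ?thesis using \<open>L < R\<close> by (simp add: abs_mult)
        qed
        then show ?thesis unfolding * using \<phi> by (intro convex_combination_abs) auto
      qed
      from d[OF E[OF z(1)] E[OF z(2)] this, of "p i"]
      show "\<bar>f z i - f z' i\<bar> \<le> \<epsilon>"
        using \<open>L < R\<close> by (simp add: f_def flip: diff_divide_distrib) (simp add: field_simps)
    qed (use \<open>d > 0\<close> \<open>L < R\<close> in auto)
  qed (use \<open>e > 0\<close> \<open>L < R\<close> in auto)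
  define w where "w = \<Phi> (E z)"
  have w: "w \<in> periodic_box T L R" unfolding w_def by (intro maps E z)
  have "\<bar>w t - E z t\<bar> \<le> e" for t
  proof -
    have "(\<Sum>i<n. w t * \<phi> i t) = w t" using \<phi>(4)[of t] by (simp flip: sum_distrib_left)
    \<comment> \<open>Both terms are averages with the same weights \<open>\<phi> i t\<close>, so
      only nodes within \<open>h\<close> of \<open>t\<close> modulo \<open>T\<close>
      contribute.\<close>
    then have *: "w t - E z t = (\<Sum>i<n. (w t - (L + (R - L) * z i)) * \<phi> i t)"
      unfolding E_def by (simp add: left_diff_distrib sum_subtractf)
    have "\<bar>w t - (L + (R - L) * z i)\<bar> \<le> e"
      if "i < n" "\<phi> i t \<noteq> 0" for i
    proof -
      obtain k :: int where k: "\<bar>t - p i + of_int k * T\<bar> < h" using near[OF \<open>\<phi> i t \<noteq> 0\<close>] ..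
      have "w t = w (t + of_int k * T)"
        using w by (auto simp: periodic_box_def periodic_shift)
      also have "\<bar>\<dots> - w (p i)\<bar> \<le> \<bar>c\<bar> * \<bar>t + of_int k * T - p i\<bar>"
        unfolding w_def using lip[OF E[OF z(1)]] by (rule order_trans) (auto intro: mult_right_mono)
      also have "\<dots> \<le> \<bar>c\<bar> * h" using k by (intro mult_left_mono) (auto simp: algebra_simps)
      finally have "\<bar>w t - w (p i)\<bar> \<le> e / 2" using ch by linarith
      moreover have "\<bar>w (p i) - (L + (R - L) * z i)\<bar> = (R - L) * \<bar>f z i - z i\<bar>"
        using \<open>L < R\<close> by (simp add: f_def w_def flip: abs_mult_pos') (simp add: field_simps)
      moreover have "(R - L) * \<bar>f z i - z i\<bar> \<le> (R - L) * (e / 2 / (R - L))"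
        using z(2) \<open>i < n\<close> \<open>L < R\<close> by (intro mult_left_mono) auto
      moreover have "(R - L) * (e / 2 / (R - L)) = e / 2"
        using \<open>L < R\<close> by (subst times_divide_eq_right, subst nonzero_mult_div_cancel_left) auto
      ultimately show ?thesis by linarith
    qed
    then show ?thesis unfolding * using \<phi> by (intro convex_combination_abs) auto
  qed
  with E[OF z(1)] show ?thesis unfolding w_def by blast
qed

text \<open>Approximate fixed points \<open>Y k\<close> with errors tending to 0 have bounded,
  equi-Lipschitz images. Compactness is applied to these images, since the \<open>Y k\<close>
  themselves carry no common modulus of continuity; along the subsequence the \<open>Y k\<close>
  then share the limit of their images, and uniform continuity makes it a fixed point.\<close>

lemma periodic_box_fixed_point:
  assumes "T > 0" "L < R"
    and maps: "\<And>y. y \<in> periodic_box T L R \<Longrightarrow> \<Phi> y \<in> periodic_box T L R"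
    and uc: "sup_uniformly_continuous_on (periodic_box T L R) \<Phi>"
    and lip: "\<And>y s t. y \<in> periodic_box T L R \<Longrightarrow> \<bar>\<Phi> y s - \<Phi> y t\<bar> \<le> c * \<bar>s - t\<bar>"
  obtains y where "y \<in> periodic_box T L R" "\<Phi> y = y"
proof -
  have "\<exists>y\<in>periodic_box T L R. \<forall>t. \<bar>\<Phi> y t - y t\<bar> \<le> inverse (Suc k)" for k
    by (rule periodic_box_approx_fixed_point[OF assms(1,2) _ maps uc lip]) auto
  then obtain Y where Y: "\<And>k. Y k \<in> periodic_box T L R" and Y_approx: "\<And>k t. \<bar>\<Phi> (Y k) t - Y k t\<bar> \<le> inverse (Suc k)"
    by metis
  have \<Phi>Y: "\<Phi> (Y k) \<in> periodic_box T L R" for k by (intro maps Y)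
  obtain g \<rho> where "strict_mono (\<rho> :: nat \<Rightarrow> nat)"
    and g: "\<And>e. 0 < e \<Longrightarrow> \<exists>N. \<forall>n x. n \<ge> N \<and> x \<in> {0..T} \<longrightarrow> norm (\<Phi> (Y (\<rho> n)) x - g x) < e"
  proof (rule Arzela_Ascoli[where S = "{0..T}" and \<F> = "\<lambda>k. \<Phi> (Y k)" and M = "\<bar>L\<bar> + \<bar>R\<bar>"])
    show "norm (\<Phi> (Y n) x) \<le> \<bar>L\<bar> + \<bar>R\<bar>" for n x
      using \<Phi>Y[of n] by (auto simp: periodic_box_def abs_le_iff) (smt (verit))+
    show "\<exists>d>0. \<forall>n y. y \<in> {0..T} \<and> norm (x - y) < d \<longrightarrow> norm (\<Phi> (Y n) x - \<Phi> (Y n) y) < e"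
      if "e > 0" for x e
    proof (intro exI[of _ "e / (\<bar>c\<bar> + 1)"] conjI allI impI)
      fix n y assume y: "y \<in> {0..T} \<and> norm (x - y) < e / (\<bar>c\<bar> + 1)"
      have "norm (\<Phi> (Y n) x - \<Phi> (Y n) y) \<le> c * \<bar>x - y\<bar>" using lip[OF Y] by simp
      also have "\<dots> \<le> (\<bar>c\<bar> + 1) * \<bar>x - y\<bar>" by (intro mult_right_mono) auto
      also have "\<dots> < e" using y by (simp add: field_simps)
      finally show "norm (\<Phi> (Y n) x - \<Phi> (Y n) y) < e" .
    qed (use that in auto)
  qed auto
  \<comment> \<open>The limit \<open>g\<close> is controlled on one period only, so it is extended
    periodically by reducing \<open>t\<close> into \<open>[0, T]\<close>.\<close>
  define w where "w t = g (t + of_int (- \<lfloor>t / T\<rfloor>) * T)" for t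
  have red: "t + of_int (- \<lfloor>t / T\<rfloor>) * T \<in> {0..T}" for t
    using floor_divide_lower[OF \<open>T > 0\<close>, of t] floor_divide_upper[OF \<open>T > 0\<close>, of t]
    by (auto simp: algebra_simps)
  have conv: "\<exists>N. \<forall>n\<ge>N. \<forall>t. \<bar>\<Phi> (Y (\<rho> n)) t - w t\<bar> < e" if "e > 0" for e
  proof -
    obtain N where N: "\<And>n x. \<lbrakk>n \<ge> N; x \<in> {0..T}\<rbrakk> \<Longrightarrow> \<bar>\<Phi> (Y (\<rho> n)) x - g x\<bar> < e"
      using g[OF \<open>e > 0\<close>] by auto
    have "\<Phi> (Y (\<rho> n)) t = \<Phi> (Y (\<rho> n)) (t + of_int (- \<lfloor>t / T\<rfloor>) * T)" for n t
      using \<Phi>Y[of "\<rho> n"] unfolding periodic_box_def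
      by (intro sym[OF periodic_shift]) auto
    then show ?thesis using N red unfolding w_def by metis
  qed
  then have lim: "(\<lambda>n. \<Phi> (Y (\<rho> n)) t) \<longlonglongrightarrow> w t" for t
    unfolding LIMSEQ_def dist_real_def by blast
  have "w \<in> periodic_box T L R"
    unfolding periodic_box_def
  proof (intro CollectI conjI allI)
    show "L \<le> w t" "w t \<le> R" for t
      using \<Phi>Y by (auto intro!: LIMSEQ_le_const[OF lim] LIMSEQ_le_const2[OF lim] simp: periodic_box_def)
    show "periodic_fun_simple w T"
    proof
      show "w (t + T) = w t" for t
        using \<Phi>Y lim[of "t + T"] lim[of t]
        by (intro LIMSEQ_unique[of "\<lambda>n. \<Phi> (Y (\<rho> n)) t"]) (auto simp: periodic_box_def periodic_fun_simple.plus_period)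
    qed
    have "uniform_limit UNIV (\<lambda>n. \<Phi> (Y (\<rho> n))) w sequentially"
      unfolding uniform_limit_iff eventually_sequentially dist_real_def using conv by blast
    then show "continuous_on UNIV w"
      using \<Phi>Y by (intro uniform_limit_theorem[of _ "\<lambda>n. \<Phi> (Y (\<rho> n))"]) (auto simp: periodic_box_def)
  qed
  moreover have "\<Phi> w = w"
  proof
    fix t
    have "\<bar>\<Phi> w t - w t\<bar> \<le> e" if "e > 0" for e
    proof -
      have "e / 2 > 0" using that by simp
      obtain d where "d > 0" and d: "\<And>y y' t. \<lbrakk>y \<in> periodic_box T L R; y' \<in> periodic_box T L R; \<And>t. \<bar>y t - y' t\<bar> \<le> d\<rbrakk>
                \<Longrightarrow> \<bar>\<Phi> y t - \<Phi> y' t\<bar> \<le> e / 2"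
        using sup_uniformly_continuous_onD[OF uc \<open>e / 2 > 0\<close>] by metis
      \<comment> \<open>\<open>2 * \<epsilon> \<le> d\<close> puts \<open>Y (\<rho> n)\<close>
        within \<open>d\<close> of \<open>w\<close>, and \<open>\<epsilon> \<le> e / 2\<close>
        absorbs the distance of its image from \<open>w\<close>.\<close>
      define \<epsilon> where "\<epsilon> = min (e / 2) (d / 2)"
      have \<epsilon>: "\<epsilon> > 0" "2 * \<epsilon> \<le> e" "2 * \<epsilon> \<le> d" using that \<open>d > 0\<close> by (auto simp: \<epsilon>_def)
      obtain N1 where N1: "\<And>n t. n \<ge> N1 \<Longrightarrow> \<bar>\<Phi> (Y (\<rho> n)) t - w t\<bar> < \<epsilon>"
        using conv[OF \<open>\<epsilon> > 0\<close>] by blast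
      obtain N2 where N2: "inverse (Suc N2) < \<epsilon>" using reals_Archimedean[OF \<open>\<epsilon> > 0\<close>] by auto
      define n where "n = max N1 N2"
      have "N2 \<le> \<rho> n" using seq_suble[OF \<open>strict_mono \<rho>\<close>, of n] by (simp add: n_def)
      then have "inverse (real (Suc (\<rho> n))) \<le> inverse (Suc N2)" by (intro le_imp_inverse_le) auto
      then have "\<bar>\<Phi> (Y (\<rho> n)) t - Y (\<rho> n) t\<bar> < \<epsilon>" for t
        using Y_approx[of "\<rho> n" t] N2 by linarith
      moreover have "\<bar>\<Phi> (Y (\<rho> n)) t - w t\<bar> < \<epsilon>" for t by (rule N1) (simp add: n_def)
      ultimately have Yw: "\<bar>\<Phi> (Y (\<rho> n)) t - Y (\<rho> n) t\<bar> < \<epsilon>" "\<bar>\<Phi> (Y (\<rho> n)) t - w t\<bar> < \<epsilon>" for t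
        by auto
      have "\<bar>w t - Y (\<rho> n) t\<bar> \<le> d" for t
        using Yw[of t] \<epsilon>(3) by linarith
      from d[OF \<open>w \<in> periodic_box T L R\<close> Y this, of t] Yw(2)[of t]
      show ?thesis using \<epsilon>(2) by linarith
    qed
    then have "\<bar>\<Phi> w t - w t\<bar> \<le> 0" by (rule field_le_epsilon) simp
    then show "\<Phi> w t = w t" by simp
  qed
  ultimately show ?thesis using that by blast
qed

section \<open>The linear equation with periodic inhomogeneity\<close>

lemma continuous_periodic_attains:
  fixes f :: "real \<Rightarrow> real"
  assumes "continuous_on UNIV f" "periodic_fun_simple f T" "T > 0"
  obtains s1 s2 where "\<And>t. f s1 \<le> f t" "\<And>t. f t \<le> f s2"
proof -
  have c: "continuous_on {0..T} f" using assms(1) continuous_on_subset by blast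
  obtain s1 where s1: "\<forall>t\<in>{0..T}. f s1 \<le> f t"
    using continuous_attains_inf[OF _ _ c] \<open>T > 0\<close> by auto
  obtain s2 where s2: "\<forall>t\<in>{0..T}. f t \<le> f s2"
    using continuous_attains_sup[OF _ _ c] \<open>T > 0\<close> by auto
  have "f s1 \<le> f t \<and> f t \<le> f s2" for t
  proof -
    obtain k :: int where "0 \<le> t + of_int k * T" "t + of_int k * T < 0 + T"
      using periodic_reduce[OF \<open>T > 0\<close>] .
    then have "t + of_int k * T \<in> {0..T}" by simp
    with s1 s2 have "f s1 \<le> f (t + of_int k * T) \<and> f (t + of_int k * T) \<le> f s2" by blast
    then show ?thesis by (simp add: periodic_shift[OF assms(2)])
  qed
  with that show ?thesis by blast
qed

lemma continuous_has_antiderivative: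
  fixes f :: "real \<Rightarrow> real"
  assumes "continuous_on UNIV f"
  obtains F where "\<And>t. (F has_real_derivative f t) (at t)"
proof -
  have "\<exists>F. \<forall>t::real. - \<infinity> < ereal t \<longrightarrow> ereal t < \<infinity> \<longrightarrow> (F has_vector_derivative f t) (at t)"
    using assms by (intro einterval_antiderivative) (auto simp: continuous_on_eq_continuous_at)
  then show ?thesis using that by (auto simp: has_real_derivative_iff_has_vector_derivative)
qed

section \<open>Maximum principle, comparison and Harnack inequality\<close>

text \<open>\<open>B\<close> is an antiderivative of \<open>b\<close>, and \<open>B_shift\<close>
  says that \<open>C\<close> is the integral of \<open>b\<close> over a period; the estimates below
  can thus be made without integrals.\<close>

locale periodic_rate =
  fixes T C :: real and b B :: "real \<Rightarrow> real"
  assumes T_pos: "T > 0" and b_cont: "continuous_on UNIV b" and b_pos: "\<And>t. b t > 0"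
    and b_per: "periodic_fun_simple b T"
    and B_deriv: "\<And>t. (B has_real_derivative b t) (at t)"
    and B_shift: "\<And>t. B (t + T) = B t + C"
begin

lemma B_mono: "s \<le> t \<Longrightarrow> B s \<le> B t"
  using B_deriv b_pos[THEN less_imp_le] DERIV_nonneg_imp_nondecreasing[of s t B] by blast

lemma C_pos: "C > 0"
proof -
  have "B 0 < B T"
    using DERIV_pos_imp_increasing[OF T_pos, of B] B_deriv b_pos by blast
  then show ?thesis using B_shift[of 0] by simp
qed

text \<open>With the integrating factor \<open>exp (B t)\<close> the derivative of the product is
  \<open>exp (B t) * f t\<close>, which is nonnegative.\<close>

lemma weighted_mono:
  assumes x: "\<And>t. (x has_real_derivative f t - b t * x t) (at t)" and f: "\<And>t. f t \<ge> 0" and "s \<le> t"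
  shows "exp (B s) * x s \<le> exp (B t) * x t"
proof (rule DERIV_nonneg_imp_nondecreasing[OF \<open>s \<le> t\<close>])
  fix u
  have "((\<lambda>u. exp (B u) * x u) has_real_derivative
      exp (B u) * b u * x u + exp (B u) * (f u - b u * x u)) (at u)"
    by (auto intro!: derivative_eq_intros x B_deriv)
  then show "\<exists>y. ((\<lambda>u. exp (B u) * x u) has_real_derivative y) (at u) \<and> y \<ge> 0"
    using f[of u] by (intro exI[of _ "exp (B u) * f u"]) (simp add: algebra_simps)
qed

text \<open>Monotonicity of the weighted solution over one period gives
  \<open>x t \<le> exp C * x t\<close>, and \<open>exp C > 1\<close>.\<close>

lemma maximum_principle:
  assumes x: "\<And>t. (x has_real_derivative f t - b t * x t) (at t)" and f: "\<And>t. f t \<ge> 0"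
    and per: "periodic_fun_simple x T"
  shows "x t \<ge> 0"
proof -
  have "exp (B t) * x t \<le> exp (B (t + T)) * x (t + T)"
    using T_pos by (intro weighted_mono[OF x f]) auto
  then have "exp (B t) * x t \<le> exp (B t) * (exp C * x t)"
    by (simp add: B_shift exp_add periodic_fun_simple.plus_period[OF per])
  then have "x t \<le> exp C * x t" by simp
  then have "0 \<le> (exp C - 1) * x t" by (simp add: algebra_simps)
  then show ?thesis using C_pos by (simp add: zero_le_mult_iff)
qed

text \<open>The constant \<open>e\<close> solves the equation with right-hand side
  \<open>e * b t\<close>, so the maximum principle applies to \<open>y + e - x\<close>.\<close>

lemma comparison:
  assumes x: "\<And>t. (x has_real_derivative f t - b t * x t) (at t)" "periodic_fun_simple x T"
    and y: "\<And>t. (y has_real_derivative g t - b t * y t) (at t)" "periodic_fun_simple y T"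
    and fg: "\<And>t. f t \<le> g t + e * b t"
  shows "x t \<le> y t + e"
proof -
  have "y t + e - x t \<ge> 0"
  proof (rule maximum_principle[of "\<lambda>t. y t + e - x t" "\<lambda>t. g t + e * b t - f t"])
    show "((\<lambda>t. y t + e - x t) has_real_derivative g t + e * b t - f t - b t * (y t + e - x t)) (at t)" for t
      by (auto intro!: derivative_eq_intros x y simp: algebra_simps)
    show "periodic_fun_simple (\<lambda>t. y t + e - x t) T"
      by standard (simp add: periodic_fun_simple.plus_period[OF x(2)] periodic_fun_simple.plus_period[OF y(2)])
  qed (use fg in \<open>simp add: algebra_simps\<close>)
  then show ?thesis by simp
qed

text \<open>By periodicity \<open>t\<close> may be moved into \<open>[s, s + T)\<close>. There the
  weighted solution has not decreased since \<open>s\<close>, while the weight has grown by a factor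
  of at most \<open>exp C\<close>.\<close>

lemma harnack:
  assumes x: "\<And>t. (x has_real_derivative f t - b t * x t) (at t)" "periodic_fun_simple x T"
    and f: "\<And>t. f t \<ge> 0"
  shows "x s \<le> exp C * x t"
proof -
  obtain k :: int where k: "s \<le> t + of_int k * T" "t + of_int k * T < s + T"
    using periodic_reduce[OF T_pos] .
  define u where "u = t + of_int k * T"
  have "exp (B s) * x s \<le> exp (B u) * x u"
    using k by (intro weighted_mono[OF x(1) f]) (auto simp: u_def)
  also have "\<dots> \<le> exp (B s + C) * x u"
    using B_mono[of u "s + T"] k maximum_principle[OF x(1) f x(2)]
    by (intro mult_right_mono) (auto simp: u_def B_shift)
  finally have "exp (B s) * x s \<le> exp (B s) * (exp C * x u)" by (simp add: exp_add)
  then show ?thesis using periodic_shift[OF x(2), of t k] by (simp add: u_def)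
qed

section \<open>The periodic solution operator\<close>

text \<open>Variation of constants: every solution is \<open>exp (- B t) * (H t + k)\<close>, and
  the constant \<open>k\<close> can be chosen to make it periodic because
  \<open>exp C \<noteq> 1\<close>.\<close>

lemma periodic_response_exists:
  assumes f: "continuous_on UNIV f" "periodic_fun_simple f T"
  shows "\<exists>x. (\<forall>t. (x has_real_derivative f t - b t * x t) (at t)) \<and> periodic_fun_simple x T"
proof -
  have "continuous_on UNIV B"
    using B_deriv DERIV_isCont by (auto simp: continuous_on_eq_continuous_at)
  then have "continuous_on UNIV (\<lambda>t. exp (B t) * f t)"
    by (intro continuous_intros f)
  then obtain H where H: "\<And>t. (H has_real_derivative exp (B t) * f t) (at t)"
    using continuous_has_antiderivative by blast
  have H': "((\<lambda>t. H (t + T) - exp C * H t) has_real_derivative 0) (at t)" for t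
  proof -
    have "((\<lambda>t. H (t + T)) has_real_derivative exp (B (t + T)) * f (t + T)) (at t)"
      using H[of "t + T"] by (simp add: DERIV_shift)
    from DERIV_diff[OF this DERIV_cmult[OF H, where c = "exp C"]] show ?thesis
      by (simp add: B_shift periodic_fun_simple.plus_period[OF f(2)] exp_add mult_ac)
  qed
  define d where "d = H T - exp C * H 0"
  have Hd: "H (t + T) = exp C * H t + d" for t
    using DERIV_isconst_all[of "\<lambda>t. H (t + T) - exp C * H t" t 0] H' by (simp add: d_def)
  \<comment> \<open>Periodicity amounts to \<open>H (t + T) + k = exp C * (H t + k)\<close>; since
    \<open>H (t + T) = exp C * H t + d\<close>, this is the equation
    \<open>d + k = exp C * k\<close>.\<close>
  define k where "k = d / (exp C - 1)"
  have k: "d + k = exp C * k" using C_pos by (simp add: k_def field_simps)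
  define x where "x t = exp (- B t) * (H t + k)" for t
  have "(x has_real_derivative f t - b t * x t) (at t)" for t
  proof -
    have "(x has_real_derivative
        exp (- B t) * (- b t) * (H t + k) + exp (- B t) * (exp (B t) * f t)) (at t)"
      unfolding x_def by (auto intro!: derivative_eq_intros H B_deriv)
    moreover have "exp (- B t) * (- b t) * (H t + k) + exp (- B t) * (exp (B t) * f t) = f t - b t * x t"
      by (simp add: x_def exp_minus)
    ultimately show ?thesis by simp
  qed
  moreover have "periodic_fun_simple x T"
  proof
    fix t
    have "H (t + T) + k = exp C * (H t + k)" using k Hd[of t] by (simp add: distrib_left)
    then show "x (t + T) = x t"
      by (simp add: x_def B_shift exp_diff)
  qed
  ultimately show ?thesis by blast
qed

text \<open>The Green operator of the periodic problem. By \<open>comparison\<close> with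
  \<open>e = 0\<close> two periodic solutions for the same \<open>f\<close> coincide, so the choice
  is unambiguous whenever a solution exists.\<close>

definition response :: "(real \<Rightarrow> real) \<Rightarrow> real \<Rightarrow> real" where
  "response f = (SOME x. (\<forall>t. (x has_real_derivative f t - b t * x t) (at t)) \<and> periodic_fun_simple x T)"

lemma response:
  assumes "continuous_on UNIV f" "periodic_fun_simple f T"
  shows response_deriv: "(response f has_real_derivative f t - b t * response f t) (at t)"
    and response_periodic: "periodic_fun_simple (response f) T"
proof -
  have "(\<forall>t. (response f has_real_derivative f t - b t * response f t) (at t)) \<and>
      periodic_fun_simple (response f) T"
    unfolding response_def by (rule someI_ex[OF periodic_response_exists[OF assms]])
  then show "(response f has_real_derivative f t - b t * response f t) (at t)"
    "periodic_fun_simple (response f) T" by blast+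
qed

text \<open>Comparison with the zero solution, the constants \<open>\<beta>\<close> and
  \<open>\<beta>'\<close> appearing as the slack \<open>e\<close>.\<close>

lemma response_bounds:
  assumes "continuous_on UNIV f" "periodic_fun_simple f T" "\<And>t. \<beta> * b t \<le> f t" "\<And>t. f t \<le> \<beta>' * b t"
  shows "\<beta> \<le> response f t" "response f t \<le> \<beta>'"
proof -
  have 0: "((\<lambda>_. 0) has_real_derivative 0 - b t * 0) (at t)" for t by simp
  have per: "periodic_fun_simple (\<lambda>_. 0::real) T" by standard simp
  show "response f t \<le> \<beta>'"
    using comparison[OF response(1,2)[OF assms(1,2)] 0 per, of \<beta>'] assms(4) by simp
  show "\<beta> \<le> response f t"
    using comparison[OF 0 per response(1,2)[OF assms(1,2)], of "- \<beta>"] assms(3) by simp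
qed

end

section \<open>Expansive periodic problems\<close>

lemma INF_bounds:
  fixes y :: "real \<Rightarrow> real"
  assumes "\<And>t. l \<le> y t"
  shows "l \<le> (INF t. y t)" "(INF t. y t) \<le> y t"
  using assms by (auto intro!: cINF_greatest cINF_lower bdd_belowI[of _ l])

lemma INF_le_INF_add:
  fixes y :: "real \<Rightarrow> real"
  assumes "\<And>t. l \<le> y t" "\<And>t. y t \<le> y' t + d"
  shows "(INF t. y t) \<le> (INF t. y' t) + d"
proof -
  have "(INF t. y t) - d \<le> y' t" for t
    using INF_bounds(2)[of l y t] assms(1) assms(2)[of t] by simp
  then have "(INF t. y t) - d \<le> (INF t. y' t)" by (rule INF_bounds(1))
  then show ?thesis by simp
qed

lemma INF_mult_left:
  fixes y :: "real \<Rightarrow> real"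
  assumes "\<And>t. l \<le> y t" "q > 0"
  shows "(INF t. q * y t) = q * (INF t. y t)"
proof (rule antisym)
  have "q * l \<le> q * y t" for t using assms by simp
  then have "(INF t. q * y t) \<le> q * y t" for t by (rule INF_bounds(2))
  then have "(INF t. q * y t) / q \<le> y t" for t using \<open>q > 0\<close> by (simp add: divide_le_eq mult.commute)
  then have "(INF t. q * y t) / q \<le> (INF t. y t)" by (rule INF_bounds(1))
  then show "(INF t. q * y t) \<le> q * (INF t. y t)" using \<open>q > 0\<close> by (simp add: divide_le_eq mult.commute)
  show "q * (INF t. y t) \<le> (INF t. q * y t)"
    using INF_bounds(2)[of l y] assms by (intro INF_bounds(1)) auto
qed

lemma dist_Pair_le: "dist (a, b) (c, d) \<le> dist a c + dist b d"
  by (simp add: dist_Pair_Pair sqrt_sum_squares_le_sum)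

lemma periodic_not_monotone:
  assumes "periodic_fun_simple y T" "T > 0" "\<And>t. (y has_real_derivative y' t) (at t)"
  shows "\<not> (\<forall>t. y' t > 0)" "\<not> (\<forall>t. y' t < 0)"
proof -
  have "y T = y 0" using periodic_fun_simple.plus_period[OF assms(1), of 0] by simp
  then show "\<not> (\<forall>t. y' t > 0)" "\<not> (\<forall>t. y' t < 0)"
    using DERIV_pos_imp_increasing[OF \<open>T > 0\<close>, of y] DERIV_neg_imp_decreasing[OF \<open>T > 0\<close>, of y] assms(3)
    by (metis less_irrefl)+
qed

context periodic_rate
begin

text \<open>The solution operator is nonexpansive from the supremum norm weighted by
  \<open>1 / b\<close> to the plain one; this passes uniform continuity from \<open>F\<close> to
  \<open>A\<close>.\<close>

lemma response_diff_le:
  assumes f: "continuous_on UNIV f" "periodic_fun_simple f T"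
    and g: "continuous_on UNIV g" "periodic_fun_simple g T"
    and fg: "\<And>t. \<bar>f t - g t\<bar> \<le> e * b t"
  shows "\<bar>response f t - response g t\<bar> \<le> e"
proof -
  have "f t \<le> g t + e * b t" "g t \<le> f t + e * b t" for t using fg[of t] by linarith+
  from comparison[OF response[OF f] response[OF g] this(1)] comparison[OF response[OF g] response[OF f] this(2)]
  have "response f t \<le> response g t + e" "response g t \<le> response f t + e" by simp_all
  then show ?thesis by linarith
qed

text \<open>\<open>F\<close> is an abstract production operator. The bounds by multiples of
  \<open>b\<close> keep \<open>A y\<close> between positive constants. \<open>low\<close> and
  \<open>high\<close> are used on fixed points of the rescaled map whose infimum is \<open>L\<close>
  or \<open>U\<close>, to exclude an active clamp; Harnack's inequality is the source of
  \<open>exp C\<close> in \<open>low\<close> and in \<open>R\<close>.\<close>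

theorem periodic_solution_exists:
  assumes "0 < L" "L < U" "R = exp C * U" "\<beta> > 0"
    and F: "\<And>y. y \<in> periodic_box T L R \<Longrightarrow> continuous_on UNIV (F y)" "\<And>y. y \<in> periodic_box T L R \<Longrightarrow> periodic_fun_simple (F y) T"
    and F_ge: "\<And>y t. y \<in> periodic_box T L R \<Longrightarrow> \<beta> * b t \<le> F y t"
    and F_le: "\<And>y t. y \<in> periodic_box T L R \<Longrightarrow> F y t \<le> \<beta>' * b t"
    and F_uc: "sup_uniformly_continuous_on (periodic_box T L R) F"
    and low: "\<And>y t. \<lbrakk>y \<in> periodic_box T L R; \<And>t. y t \<le> exp C * L\<rbrakk> \<Longrightarrow> F y t < b t * L"
    and high: "\<And>y t. \<lbrakk>y \<in> periodic_box T L R; \<And>t. U \<le> y t\<rbrakk> \<Longrightarrow> b t * R < F y t"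
  obtains x where "x \<in> periodic_box T L R" "\<And>t. (x has_real_derivative F x t - b t * x t) (at t)"
proof -
  obtain s1 s2 where s: "\<And>t. b s1 \<le> b t" "\<And>t. b t \<le> b s2"
    using continuous_periodic_attains[OF b_cont b_per T_pos] by blast
  have "L < R" using assms(1-3) C_pos mult_strict_mono[of 1 "exp C" L U] by simp
  define A where "A y = response (F y)" for y
  define p where "p y = (INF t. y t)" for y :: "real \<Rightarrow> real"
  define g where "g p a v = max L (min U (p\<^sup>2 / a)) / a * v" for p a v :: real
  \<comment> \<open>In terms of logarithms of minima: a fixed point of the clamped map \<open>s \<mapsto> 2 s - log (min (A y))\<close>,
    which reverses the expansion of \<open>s \<mapsto> log (min (A y))\<close>.\<close>
  define \<Phi> where "\<Phi> y t = g (p y) (p (A y)) (A y t)" for y t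
  note A_deriv = response_deriv[OF F, folded A_def] and A_per = response_periodic[OF F, folded A_def]
  have A_bounds: "\<beta> \<le> A y t" "A y t \<le> \<beta>'" if "y \<in> periodic_box T L R" for y t
    using response_bounds[OF F[OF that] F_ge[OF that] F_le[OF that]] by (simp_all add: A_def)
  have pA: "\<beta> \<le> p (A y)" "p (A y) \<le> A y t" if "y \<in> periodic_box T L R" for y t
    unfolding p_def using A_bounds(1)[OF that] by (rule INF_bounds)+
  have py: "L \<le> p y" "p y \<le> y t" if "y \<in> periodic_box T L R" for y t
    unfolding p_def using that by (auto simp: periodic_box_def intro: INF_bounds[of L])
  have F_nonneg: "F y t \<ge> 0" if "y \<in> periodic_box T L R" for y t
    using F_ge[OF that, of t] mult_pos_pos[OF \<open>\<beta> > 0\<close> b_pos[of t]] by linarith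
  have A_le_p: "A y t \<le> exp C * p (A y)" if "y \<in> periodic_box T L R" for y t
  proof -
    have "A y t / exp C \<le> A y s" for s
      using harnack[OF A_deriv[OF that that] A_per[OF that that] F_nonneg[OF that], of t s]
      by (simp add: divide_le_eq mult.commute)
    then have "A y t / exp C \<le> p (A y)" unfolding p_def by (rule INF_bounds(1))
    then show ?thesis by (simp add: divide_le_eq mult.commute)
  qed
  have A_cont: "continuous_on UNIV (A y)" if "y \<in> periodic_box T L R" for y
    using A_deriv[OF that that] DERIV_isCont by (auto simp: continuous_on_eq_continuous_at)
  \<comment> \<open>The Lipschitz constant is the largest scaling factor \<open>U / \<beta>\<close>
    times a bound for the derivative \<open>F y - b * A y\<close>: both of its terms lie between 0
    and \<open>\<beta>' * b s2\<close>.\<close>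
  obtain y where y: "y \<in> periodic_box T L R" and fix_y: "\<Phi> y = y"
  proof (rule periodic_box_fixed_point[OF T_pos \<open>L < R\<close>, of \<Phi> "U / \<beta> * (\<beta>' * b s2)"])
    fix y assume y: "y \<in> periodic_box T L R"
    \<comment> \<open>\<open>c\<close> is the infimum of the rescaled function. It lies in
      \<open>[L, U]\<close>, and Harnack's inequality bounds the values by
      \<open>exp C * c \<le> R\<close>, so the box is invariant even where \<open>A\<close> leaves
      it.\<close>
    define c where "c = max L (min U ((p y)\<^sup>2 / p (A y)))"
    define a where "a = p (A y)"
    have c: "L \<le> c" "c \<le> U" using \<open>L < U\<close> by (auto simp: c_def)
    have a: "a > 0" "\<beta> \<le> a" "\<And>t. a \<le> A y t" "\<And>t. A y t \<le> exp C * a"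
      using pA[OF y] A_le_p[OF y] \<open>\<beta> > 0\<close> by (auto simp: a_def intro: less_le_trans)
    have \<Phi>_eq: "\<Phi> y = (\<lambda>t. c / a * A y t)" by (rule ext) (simp add: \<Phi>_def g_def c_def a_def)
    show "\<Phi> y \<in> periodic_box T L R"
      unfolding periodic_box_def
    proof (intro CollectI conjI allI)
      show "continuous_on UNIV (\<Phi> y)"
        unfolding \<Phi>_eq by (intro continuous_intros A_cont y)
      show "periodic_fun_simple (\<Phi> y) T"
        unfolding \<Phi>_eq by standard (simp add: periodic_fun_simple.plus_period[OF A_per[OF y y]])
      show "L \<le> \<Phi> y t" for t
      proof -
        have "L \<le> c / a * a" using c a by simp
        also have "\<dots> \<le> c / a * A y t" using c a \<open>0 < L\<close> by (intro mult_left_mono) auto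
        finally show ?thesis by (simp add: \<Phi>_eq)
      qed
      show "\<Phi> y t \<le> R" for t
      proof -
        have "c / a * A y t \<le> c / a * (exp C * a)" using c a \<open>0 < L\<close> by (intro mult_left_mono) auto
        also have "\<dots> = exp C * c" using a by simp
        also have "\<dots> \<le> R" using c by (simp add: \<open>R = _\<close>)
        finally show ?thesis by (simp add: \<Phi>_eq)
      qed
    qed
    fix s t
    have "\<bar>A y s - A y t\<bar> \<le> \<beta>' * b s2 * \<bar>s - t\<bar>"
    proof -
      have "norm (A y s - A y t) \<le> \<beta>' * b s2 * norm (s - t)"
      proof (rule field_differentiable_bound[OF convex_UNIV])
        show "(A y has_field_derivative F y z - b z * A y z) (at z within UNIV)" for z
          using A_deriv[OF y y] by simp
        show "norm (F y z - b z * A y z) \<le> \<beta>' * b s2" for z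
        proof -
          have "0 < \<beta>'" using A_bounds[OF y, of z] \<open>\<beta> > 0\<close> by linarith
          then have "\<beta>' * b z \<le> \<beta>' * b s2" using s(2) by (intro mult_left_mono) auto
          moreover have "b z * A y z \<le> b z * \<beta>'" using A_bounds[OF y] b_pos[of z] by (intro mult_left_mono) auto
          moreover have "b z * A y z \<ge> 0" using A_bounds(1)[OF y, of z] b_pos[of z] \<open>\<beta> > 0\<close> by simp
          ultimately show ?thesis
            using F_nonneg[OF y, of z] F_le[OF y, of z] by (simp add: abs_le_iff mult.commute)
        qed
      qed auto
      then show ?thesis by simp
    qed
    moreover have "c / a \<le> U / \<beta>" using c a \<open>\<beta> > 0\<close> \<open>0 < L\<close> by (intro frac_le) auto
    moreover have "0 \<le> c / a" using c a \<open>0 < L\<close> by simp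
    ultimately have "c / a * \<bar>A y s - A y t\<bar> \<le> U / \<beta> * (\<beta>' * b s2 * \<bar>s - t\<bar>)"
      by (intro mult_mono) auto
    moreover have "\<bar>\<Phi> y s - \<Phi> y t\<bar> = c / a * \<bar>A y s - A y t\<bar>"
      unfolding \<Phi>_eq right_diff_distrib[symmetric] abs_mult abs_of_nonneg[OF \<open>0 \<le> c / a\<close>] ..
    ultimately show "\<bar>\<Phi> y s - \<Phi> y t\<bar> \<le> U / \<beta> * (\<beta>' * b s2) * \<bar>s - t\<bar>" by (simp add: mult.assoc)
  next
    show "sup_uniformly_continuous_on (periodic_box T L R) \<Phi>"
      unfolding sup_uniformly_continuous_on_def
    proof (intro allI impI)
      fix e :: real assume "e > 0"
      \<comment> \<open>\<open>\<Phi> y t\<close> is \<open>g\<close> evaluated at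
        \<open>(p y, p (A y), A y t)\<close>, a point of this compact set. It remains to see that
        each of the three entries moves little with \<open>y\<close>.\<close>
      define K where "K = {L..R} \<times> {\<beta>..\<beta>'} \<times> {\<beta>..\<beta>'}"
      have "continuous_on K (\<lambda>(p, a, v). g p a v)"
        unfolding g_def case_prod_unfold K_def
        using \<open>\<beta> > 0\<close> by (intro continuous_intros) auto
      then have "uniformly_continuous_on K (\<lambda>(p, a, v). g p a v)"
        by (rule compact_uniformly_continuous) (simp add: K_def compact_Times)
      then obtain \<delta> where "\<delta> > 0" and \<delta>: "\<And>k k'. \<lbrakk>k \<in> K; k' \<in> K; dist k' k < \<delta>\<rbrakk> \<Longrightarrow>
          dist ((\<lambda>(p, a, v). g p a v) k') ((\<lambda>(p, a, v). g p a v) k) < e"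
        using \<open>e > 0\<close> unfolding uniformly_continuous_on_def by blast
      \<comment> \<open>Three entries, each moving by at most \<open>\<epsilon>\<close>, stay
        strictly below \<open>\<delta>\<close>. The factor \<open>b s1\<close> below converts an
        absolute bound on \<open>F\<close> into one weighted by \<open>b\<close>.\<close>
      define \<epsilon> where "\<epsilon> = \<delta> / 4"
      have "\<epsilon> * b s1 > 0" using \<open>\<delta> > 0\<close> b_pos by (simp add: \<epsilon>_def)
      from sup_uniformly_continuous_onD[OF F_uc this] obtain d where "d > 0"
        and d: "\<And>y y' t. \<lbrakk>y \<in> periodic_box T L R; y' \<in> periodic_box T L R; \<And>t. \<bar>y t - y' t\<bar> \<le> d\<rbrakk>
                  \<Longrightarrow> \<bar>F y t - F y' t\<bar> \<le> \<epsilon> * b s1" by metis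
      show "\<exists>d>0. \<forall>y\<in>periodic_box T L R. \<forall>y'\<in>periodic_box T L R. (\<forall>t. \<bar>y t - y' t\<bar> \<le> d) \<longrightarrow> (\<forall>t. \<bar>\<Phi> y t - \<Phi> y' t\<bar> \<le> e)"
      proof (intro exI[of _ "min d \<epsilon>"] conjI ballI impI allI)
        fix y y' t
        assume y: "y \<in> periodic_box T L R" and y': "y' \<in> periodic_box T L R" and close: "\<forall>t. \<bar>y t - y' t\<bar> \<le> min d \<epsilon>"
        have "\<bar>F y t - F y' t\<bar> \<le> \<epsilon> * b t" for t
        proof -
          have "\<bar>F y t - F y' t\<bar> \<le> \<epsilon> * b s1" using close by (intro d y y') simp
          also have "\<dots> \<le> \<epsilon> * b t" using s(1) \<open>\<delta> > 0\<close> by (intro mult_left_mono) (auto simp: \<epsilon>_def)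
          finally show ?thesis .
        qed
        then have dA: "\<bar>A y t - A y' t\<bar> \<le> \<epsilon>" for t
          unfolding A_def by (intro response_diff_le F y y')
        have INF_close: "\<bar>p u - p u'\<bar> \<le> \<epsilon>"
          if "\<And>t. l \<le> u t" "\<And>t. l \<le> u' t" "\<And>t. \<bar>u t - u' t\<bar> \<le> \<epsilon>" for u u' l
        proof -
          have "u t \<le> u' t + \<epsilon>" "u' t \<le> u t + \<epsilon>" for t using that(3)[of t] by linarith+
          then have "p u \<le> p u' + \<epsilon>" "p u' \<le> p u + \<epsilon>"
            unfolding p_def using that(1,2) by (intro INF_le_INF_add[of l]; blast)+
          then show ?thesis by linarith
        qed
        have "\<bar>p y - p y'\<bar> \<le> \<epsilon>"
          using y y' close by (intro INF_close[of L]) (auto simp: periodic_box_def)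
        moreover have "\<bar>p (A y) - p (A y')\<bar> \<le> \<epsilon>"
          using A_bounds y y' dA by (intro INF_close[of \<beta>]) auto
        ultimately have "dist (p y, p (A y), A y t) (p y', p (A y'), A y' t) \<le> \<epsilon> + (\<epsilon> + \<epsilon>)"
          using dA[of t]
          by (intro order_trans[OF dist_Pair_le] add_mono) (auto simp: dist_real_def)
        also have "\<dots> < \<delta>" using \<open>\<delta> > 0\<close> by (simp add: \<epsilon>_def)
        finally have "dist (p y, p (A y), A y t) (p y', p (A y'), A y' t) < \<delta>" .
        moreover have "(p y, p (A y), A y t) \<in> K" if "y \<in> periodic_box T L R" for y
        proof -
          have "p y \<le> R" using py(2)[OF that, of t] that by (auto simp: periodic_box_def intro: order_trans)
          moreover have "p (A y) \<le> \<beta>'" using pA(2)[OF that, of t] A_bounds(2)[OF that, of t] by linarith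
          ultimately show ?thesis
            using py(1)[OF that] pA(1)[OF that] A_bounds[OF that, of t] by (auto simp: K_def)
        qed
        ultimately have "dist (\<Phi> y t) (\<Phi> y' t) < e"
          using \<delta>[of "(p y', p (A y'), A y' t)" "(p y, p (A y), A y t)"] y y' by (simp add: \<Phi>_def)
        then show "\<bar>\<Phi> y t - \<Phi> y' t\<bar> \<le> e" by (simp add: dist_real_def)
      qed (use \<open>d > 0\<close> \<open>\<delta> > 0\<close> in \<open>simp add: \<epsilon>_def\<close>)
    qed
  qed (rule that)
  define a where "a = p (A y)"
  define q where "q = max L (min U ((p y)\<^sup>2 / a)) / a"
  have "a > 0" using pA(1)[OF y] \<open>\<beta> > 0\<close> by (simp add: a_def)
  then have "q > 0" using \<open>0 < L\<close> by (simp add: q_def)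
  have y_eq: "y t = q * A y t" for t
    using fun_cong[OF fix_y, of t] by (simp add: \<Phi>_def g_def q_def a_def)
  have p_eq: "p y = q * a"
    unfolding a_def p_def using INF_mult_left[OF A_bounds(1)[OF y] \<open>q > 0\<close>] y_eq by simp
  \<comment> \<open>At a fixed point \<open>p y = q * a\<close>, so the unclamped target
    \<open>(p y)\<^sup>2 / a\<close> equals \<open>q * p y\<close>. Where the clamp is inactive this
    forces \<open>q = 1\<close>.\<close>
  have clamp: "p y = max L (min U (q * p y))"
  proof -
    have *: "(p y)\<^sup>2 / a = q * p y" using \<open>a > 0\<close> by (simp add: p_eq power2_eq_square)
    have "q * a = max L (min U ((p y)\<^sup>2 / a))" using \<open>a > 0\<close> by (simp add: q_def)
    with p_eq have "p y = max L (min U ((p y)\<^sup>2 / a))" by (rule trans)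
    then show ?thesis unfolding * .
  qed
  have y_per: "periodic_fun_simple y T" using y by (simp add: periodic_box_def)
  have y_deriv: "(y has_real_derivative q * F y t - b t * y t) (at t)" for t
  proof -
    have "((\<lambda>t. q * A y t) has_real_derivative q * (F y t - b t * A y t)) (at t)"
      by (intro DERIV_cmult A_deriv y)
    moreover have "y = (\<lambda>t. q * A y t)" using y_eq by auto
    ultimately show ?thesis using y_eq[of t] by (simp add: right_diff_distrib mult.left_commute)
  qed
  \<comment> \<open>An active lower clamp means \<open>p y = L\<close> and \<open>q < 1\<close>.
    Then \<open>q * F y \<le> F y < b * L \<le> b * y\<close>, so \<open>y\<close> would be strictly
    decreasing.\<close>
  have "\<not> q * p y < L"
  proof
    assume *: "q * p y < L"
    then have "p y = L" using clamp by simp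
    then have "q < 1" using * \<open>0 < L\<close> by simp
    have "y t \<le> exp C * L" for t
      using A_le_p[OF y, of t] \<open>q > 0\<close> y_eq[of t] p_eq \<open>p y = L\<close>
      by (simp add: a_def mult.left_commute)
    then have "F y t < b t * L" for t by (intro low y)
    moreover have "q * F y t \<le> F y t" for t
      using F_nonneg[OF y] \<open>q < 1\<close> by (intro mult_left_le_one_le) (use \<open>q > 0\<close> in auto)
    moreover have "b t * L \<le> b t * y t" for t
      using py[OF y] b_pos[of t] \<open>p y = L\<close> by simp
    ultimately have "q * F y t - b t * y t < 0" for t by (smt (verit))
    then show False using periodic_not_monotone(2)[OF y_per T_pos y_deriv] by blast
  qed
  \<comment> \<open>Symmetrically, \<open>p y = U\<close> and \<open>q > 1\<close> give
    \<open>b * y \<le> b * R < F y \<le> q * F y\<close>, so \<open>y\<close> would be strictly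
    increasing.\<close>
  moreover have "\<not> q * p y > U"
  proof
    assume *: "q * p y > U"
    then have "p y = U" using clamp \<open>L < U\<close> by simp
    then have "q > 1" using * \<open>0 < L\<close> \<open>L < U\<close> by simp
    have "U \<le> y t" for t using py(2)[OF y, of t] \<open>p y = U\<close> by simp
    then have "b t * R < F y t" for t by (intro high y)
    moreover have "F y t \<le> q * F y t" for t
      using F_nonneg[OF y, of t] \<open>q > 1\<close> mult_right_mono[of 1 q "F y t"] by simp
    moreover have "b t * y t \<le> b t * R" for t
      using y b_pos[of t] by (simp add: periodic_box_def)
    ultimately have "q * F y t - b t * y t > 0" for t by (smt (verit))
    then show False using periodic_not_monotone(1)[OF y_per T_pos y_deriv] by blast
  qed
  ultimately have "q * p y = p y" using clamp by simp
  then have "q = 1" using py(1)[OF y] \<open>0 < L\<close> by simp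
  with y y_deriv that show ?thesis by simp
qed

end

section \<open>Delayed production terms\<close>

lemma sup_uniformly_continuous_on_sum:
  assumes "finite I" "\<And>i. i \<in> I \<Longrightarrow> sup_uniformly_continuous_on S (\<Phi> i)"
  shows "sup_uniformly_continuous_on S (\<lambda>y t. \<Sum>i\<in>I. \<Phi> i y t)"
  using assms
proof (induction I rule: finite_induct)
  case empty
  show ?case by (auto simp: sup_uniformly_continuous_on_def intro: exI[of _ 1])
next
  case (insert i I)
  show ?case
    unfolding sup_uniformly_continuous_on_def
  proof (intro allI impI)
    fix e :: real assume "e > 0"
    then have "e / 2 > 0" by simp
    have \<Phi>i: "sup_uniformly_continuous_on S (\<Phi> i)"
      and \<Phi>I: "sup_uniformly_continuous_on S (\<lambda>y t. \<Sum>i\<in>I. \<Phi> i y t)"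
      using insert by auto
    obtain d1 where "d1 > 0" and d1: "\<And>y y' t. \<lbrakk>y \<in> S; y' \<in> S; \<And>t. \<bar>y t - y' t\<bar> \<le> d1\<rbrakk> \<Longrightarrow>
        \<bar>\<Phi> i y t - \<Phi> i y' t\<bar> \<le> e / 2"
      using sup_uniformly_continuous_onD[OF \<Phi>i \<open>e / 2 > 0\<close>] by metis
    obtain d2 where "d2 > 0" and d2: "\<And>y y' t. \<lbrakk>y \<in> S; y' \<in> S; \<And>t. \<bar>y t - y' t\<bar> \<le> d2\<rbrakk> \<Longrightarrow>
        \<bar>(\<Sum>i\<in>I. \<Phi> i y t) - (\<Sum>i\<in>I. \<Phi> i y' t)\<bar> \<le> e / 2"
      using sup_uniformly_continuous_onD[OF \<Phi>I \<open>e / 2 > 0\<close>] by metis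
    show "\<exists>d>0. \<forall>y\<in>S. \<forall>y'\<in>S. (\<forall>t. \<bar>y t - y' t\<bar> \<le> d) \<longrightarrow>
        (\<forall>t. \<bar>(\<Sum>i\<in>insert i I. \<Phi> i y t) - (\<Sum>i\<in>insert i I. \<Phi> i y' t)\<bar> \<le> e)"
    proof (intro exI[of _ "min d1 d2"] conjI ballI impI allI)
      fix y y' t assume y: "y \<in> S" "y' \<in> S" "\<forall>t. \<bar>y t - y' t\<bar> \<le> min d1 d2"
      have "\<bar>\<Phi> i y t - \<Phi> i y' t\<bar> \<le> e / 2" using y by (intro d1) auto
      moreover have "\<bar>(\<Sum>i\<in>I. \<Phi> i y t) - (\<Sum>i\<in>I. \<Phi> i y' t)\<bar> \<le> e / 2" using y by (intro d2) auto
      ultimately show "\<bar>(\<Sum>i\<in>insert i I. \<Phi> i y t) - (\<Sum>i\<in>insert i I. \<Phi> i y' t)\<bar> \<le> e"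
        unfolding sum.insert[OF insert.hyps] by linarith
    qed (use \<open>d1 > 0\<close> \<open>d2 > 0\<close> in simp)
  qed
qed

text \<open>\<open>h\<close> is uniformly continuous on the compact square, and evaluation at any
  times \<open>\<sigma> t\<close> and \<open>\<rho> t\<close> does not increase supremum distances;
  the delays may therefore vary freely with \<open>t\<close>.\<close>

lemma sup_uniformly_continuous_on_superposition:
  assumes h: "continuous_on ({L..R} \<times> {L..R}) h" and w: "\<And>t. \<bar>w t\<bar> \<le> W"
  shows "sup_uniformly_continuous_on (periodic_box T L R) (\<lambda>y t. w t * h (y (\<sigma> t), y (\<rho> t)) :: real)"
  unfolding sup_uniformly_continuous_on_def
proof (intro allI impI)
  fix e :: real assume "e > 0"
  have "W \<ge> 0" using w[of 0] by linarith
  then have "e / (W + 1) > 0" using \<open>e > 0\<close> by simp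
  moreover have "uniformly_continuous_on ({L..R} \<times> {L..R}) h"
    using h by (rule compact_uniformly_continuous) (simp add: compact_Times)
  ultimately obtain \<delta> where "\<delta> > 0" and \<delta>: "\<And>k k'. \<lbrakk>k \<in> {L..R} \<times> {L..R}; k' \<in> {L..R} \<times> {L..R}; dist k' k < \<delta>\<rbrakk> \<Longrightarrow>
          dist (h k') (h k) < e / (W + 1)"
    unfolding uniformly_continuous_on_def by blast
  show "\<exists>d>0. \<forall>y\<in>periodic_box T L R. \<forall>y'\<in>periodic_box T L R. (\<forall>t. \<bar>y t - y' t\<bar> \<le> d) \<longrightarrow>
      (\<forall>t. \<bar>w t * h (y (\<sigma> t), y (\<rho> t)) - w t * h (y' (\<sigma> t), y' (\<rho> t))\<bar> \<le> e)"
  proof (intro exI[of _ "\<delta> / 3"] conjI ballI impI allI)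
    fix y y' t assume y: "y \<in> periodic_box T L R" "y' \<in> periodic_box T L R" "\<forall>t. \<bar>y t - y' t\<bar> \<le> \<delta> / 3"
    have "dist (y (\<sigma> t), y (\<rho> t)) (y' (\<sigma> t), y' (\<rho> t)) \<le> \<delta> / 3 + \<delta> / 3"
      using y(3) by (intro order_trans[OF dist_Pair_le] add_mono) (auto simp: dist_real_def)
    also have "\<dots> < \<delta>" using \<open>\<delta> > 0\<close> by simp
    finally have "dist (h (y (\<sigma> t), y (\<rho> t))) (h (y' (\<sigma> t), y' (\<rho> t))) < e / (W + 1)"
      using y by (intro \<delta>) (auto simp: periodic_box_def)
    then have "\<bar>w t\<bar> * \<bar>h (y (\<sigma> t), y (\<rho> t)) - h (y' (\<sigma> t), y' (\<rho> t))\<bar> \<le> (W + 1) * (e / (W + 1))"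
      using w[of t] \<open>W \<ge> 0\<close> by (intro mult_mono) (auto simp: dist_real_def)
    then show "\<bar>w t * h (y (\<sigma> t), y (\<rho> t)) - w t * h (y' (\<sigma> t), y' (\<rho> t))\<bar> \<le> e"
      using \<open>W \<ge> 0\<close> by (simp add: abs_mult flip: right_diff_distrib)
  qed (use \<open>\<delta> > 0\<close> in simp)
qed

text \<open>For periodic \<open>b\<close> the increment \<open>B (t + T) - B t\<close> has
  derivative 0; its value at \<open>t = 0\<close> is the integral over one period.\<close>

lemma periodic_rateI:
  fixes b :: "real \<Rightarrow> real"
  assumes "T > 0" "continuous_on UNIV b" "\<And>t. b t > 0" "periodic_fun_simple b T" "C = integral {0..T} b"
  obtains B where "periodic_rate T C b B"
proof -
  obtain B where B: "\<And>t. (B has_real_derivative b t) (at t)"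
    using continuous_has_antiderivative[OF assms(2)] by blast
  have "(b has_integral (B T - B 0)) {0..T}"
    using \<open>T > 0\<close> B
    by (intro fundamental_theorem_of_calculus)
      (auto simp: has_real_derivative_iff_has_vector_derivative intro: has_vector_derivative_at_within)
  then have C: "C = B T - B 0" using assms(5) by (simp add: integral_unique)
  have "((\<lambda>t. B (t + T) - B t) has_real_derivative 0) (at t)" for t
  proof -
    have "((\<lambda>t. B (t + T)) has_real_derivative b (t + T)) (at t)"
      using B[of "t + T"] by (simp add: DERIV_shift)
    from DERIV_diff[OF this B] show ?thesis
      by (simp add: periodic_fun_simple.plus_period[OF assms(4)])
  qed
  then have shift: "B (t + T) - B t = B T - B 0" for t
    using DERIV_isconst_all[of "\<lambda>t. B (t + T) - B t" t 0] by simp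
  have "B (t + T) = B t + C" for t using C shift[of t] by simp
  then have "periodic_rate T C b B" using assms(1-4) B by (intro periodic_rate.intro) auto
  then show ?thesis by (rule that)
qed

section \<open>Estimates for the delayed production terms\<close>

locale delayed_production = periodic_rate +
  fixes M :: nat and lam m n :: "nat \<Rightarrow> real" and r \<tau> \<mu> :: "nat \<Rightarrow> real \<Rightarrow> real"
  assumes coeff_pos: "\<And>k. k \<in> {1..M} \<Longrightarrow> lam k > 0" "\<And>k. k \<in> {1..M} \<Longrightarrow> m k > 0" "\<And>k. k \<in> {1..M} \<Longrightarrow> n k > 0"
    and r: "\<And>k. k \<in> {1..M} \<Longrightarrow> continuous_on UNIV (r k)" "\<And>k t. k \<in> {1..M} \<Longrightarrow> r k t > 0"
      "\<And>k. k \<in> {1..M} \<Longrightarrow> periodic_fun_simple (r k) T"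
    and \<tau>: "\<And>k. k \<in> {1..M} \<Longrightarrow> continuous_on UNIV (\<tau> k)" "\<And>k. k \<in> {1..M} \<Longrightarrow> periodic_fun_simple (\<tau> k) T"
    and \<mu>: "\<And>k. k \<in> {1..M} \<Longrightarrow> continuous_on UNIV (\<mu> k)" "\<And>k. k \<in> {1..M} \<Longrightarrow> periodic_fun_simple (\<mu> k) T"
begin

definition production :: "nat \<Rightarrow> (real \<Rightarrow> real) \<Rightarrow> real \<Rightarrow> real" where
  "production k y t = lam k * r k t * (y (t - \<tau> k t) powr m k / (1 + y (t - \<mu> k t) powr n k))"

text \<open>Numerator and denominator are increasing in values of \<open>y\<close> taken at
  different times, so each bound pairs one end of the range above with the other end below.\<close>

lemma production_bounds:
  assumes "k \<in> {1..M}" "0 < l" "\<And>t. l \<le> y t" "\<And>t. y t \<le> u"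
  shows "lam k * r k t * (l powr m k / (1 + u powr n k)) \<le> production k y t"
    and "production k y t \<le> lam k * r k t * (u powr m k / (1 + l powr n k))"
proof -
  have y: "0 < y t" "0 \<le> y t" for t using assms(2) assms(3)[of t] by auto
  have pos: "0 < 1 + l powr n k" "0 < 1 + y t powr n k" for t by (simp_all add: add_pos_nonneg)
  have c: "0 \<le> lam k * r k t" using coeff_pos(1) r(2) assms(1) by (simp add: less_imp_le)
  show "lam k * r k t * (l powr m k / (1 + u powr n k)) \<le> production k y t"
    unfolding production_def using assms coeff_pos y pos
    by (intro mult_left_mono[OF _ c] frac_le powr_mono2 add_left_mono) (auto simp: less_imp_le)
  show "production k y t \<le> lam k * r k t * (u powr m k / (1 + l powr n k))"
    unfolding production_def using assms coeff_pos y pos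
    by (intro mult_left_mono[OF _ c] frac_le powr_mono2 add_left_mono) (auto simp: less_imp_le)
qed

lemma production_nonneg: "k \<in> {1..M} \<Longrightarrow> production k y t \<ge> 0"
  using coeff_pos(1)[of k] r(2)[of k t] by (simp add: production_def add_nonneg_nonneg)

lemma production_continuous:
  assumes "k \<in> {1..M}" "y \<in> periodic_box T L R" "0 < L"
  shows "continuous_on UNIV (production k y)"
proof -
  have y: "continuous_on UNIV y" "y t > 0" for t
    using assms(2,3) by (auto simp: periodic_box_def intro: less_le_trans)
  have "continuous_on UNIV (\<lambda>t. y (t - \<tau> k t))" "continuous_on UNIV (\<lambda>t. y (t - \<mu> k t))"
    using assms(1) by (auto intro!: continuous_on_compose2[OF y(1)] continuous_intros \<tau> \<mu>)
  then show ?thesis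
    unfolding production_def using y(2) r(1)[OF assms(1)]
    by (intro continuous_intros) (auto simp: less_imp_neq[symmetric] add_pos_nonneg intro: less_imp_neq[symmetric])
qed

lemma production_periodic:
  assumes "k \<in> {1..M}" "y \<in> periodic_box T L R"
  shows "periodic_fun_simple (production k y) T"
proof
  fix t
  have y: "y (s + T) = y s" for s
    using assms(2) by (simp add: periodic_box_def periodic_fun_simple.plus_period)
  have "y (t + T - \<tau> k (t + T)) = y (t - \<tau> k t)" "y (t + T - \<mu> k (t + T)) = y (t - \<mu> k t)"
    using y[of "t - \<tau> k t"] y[of "t - \<mu> k t"]
      periodic_fun_simple.plus_period[OF \<tau>(2)[OF assms(1)]] periodic_fun_simple.plus_period[OF \<mu>(2)[OF assms(1)]]
    by (simp_all add: diff_add_eq)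
  then show "production k y (t + T) = production k y t"
    using r(3)[OF assms(1)] by (simp add: production_def periodic_fun_simple.plus_period)
qed

lemma r_bounds:
  assumes "k \<in> {1..M}"
  obtains r1 r2 where "0 < r1" "\<And>t. r1 \<le> r k t" "\<And>t. r k t \<le> r2"
  using continuous_periodic_attains[OF r(1,3)[OF assms] T_pos] r(2)[OF assms] by metis

lemma production_uniformly_continuous:
  assumes "k \<in> {1..M}" "0 < L"
  shows "sup_uniformly_continuous_on (periodic_box T L R) (production k)"
proof -
  obtain r1 r2 where r12: "0 < r1" "\<And>t. r1 \<le> r k t" "\<And>t. r k t \<le> r2" using r_bounds[OF assms(1)] by metis
  define h where "h = (\<lambda>z::real \<times> real. fst z powr m k / (1 + snd z powr n k))"
  have "continuous_on ({L..R} \<times> {L..R}) h"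
    unfolding h_def using \<open>0 < L\<close>
    by (intro continuous_intros) (auto simp: add_pos_nonneg less_imp_neq[symmetric])
  moreover have "\<bar>lam k * r k t\<bar> \<le> lam k * r2" for t
    using coeff_pos(1)[OF assms(1)] r12(1) r12(2)[of t] r12(3)[of t] by (simp add: abs_mult)
  ultimately have "sup_uniformly_continuous_on (periodic_box T L R)
      (\<lambda>y t. (lam k * r k t) * h (y (t - \<tau> k t), y (t - \<mu> k t)))"
    by (rule sup_uniformly_continuous_on_superposition)
  moreover have "production k = (\<lambda>y t. (lam k * r k t) * h (y (t - \<tau> k t), y (t - \<mu> k t)))"
    by (intro ext) (simp add: production_def h_def)
  ultimately show ?thesis by simp
qed

text \<open>On the range from \<open>exp u\<close> to \<open>exp (C + u)\<close> the term
  \<open>j\<close> is at least of order \<open>exp (u * (m j - n j))\<close>, while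
  \<open>b t * exp (C + u)\<close> is of order \<open>exp u\<close>; the former wins for large
  \<open>u\<close> because \<open>m j - n j > 1\<close>.\<close>

lemma production_large:
  assumes j: "j \<in> {1..M}" "m j > n j + 1"
  obtains u where "\<gamma> < u"
    "\<And>y t. \<lbrakk>\<And>t. exp u \<le> y t; \<And>t. y t \<le> exp (C + u)\<rbrakk> \<Longrightarrow> b t * exp (C + u) < production j y t"
proof -
  obtain r1 where r1: "0 < r1" "\<And>t. r1 \<le> r j t" using r_bounds[OF j(1)] by metis
  obtain s where s: "\<And>t. b t \<le> b s"
    using continuous_periodic_attains[OF b_cont b_per T_pos] by blast
  define a where "a = m j - n j - 1"
  \<comment> \<open>After replacing \<open>1 + exp ((C + u) * n j)\<close> by twice the exponential,
    which accounts for the factor 2 and for \<open>u \<ge> 0\<close>, the claim reduces to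
    \<open>Q < exp (u * a)\<close>. It follows from \<open>Q \<le> u * a\<close>.\<close>
  define Q where "Q = 2 * b s * exp (C + C * n j) / (lam j * r1)"
  define u where "u = max (\<gamma> + 1) (max 0 (Q / a))"
  have "a > 0" using j(2) by (simp add: a_def)
  have lr: "lam j * r1 > 0" using coeff_pos(1)[OF j(1)] r1 by simp
  have "Q \<le> u * a" using \<open>a > 0\<close> by (simp add: u_def pos_divide_le_eq[symmetric])
  then have Q: "Q < exp (u * a)" using exp_ge_add_one_self[of "u * a"] by linarith
  show ?thesis
  proof
    show "\<gamma> < u" by (simp add: u_def)
    fix y :: "real \<Rightarrow> real" and t assume y: "\<And>t. exp u \<le> y t" "\<And>t. y t \<le> exp (C + u)"
    have "0 \<le> (C + u) * n j"
      using C_pos coeff_pos(3)[OF j(1)] by (simp add: u_def)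
    then have *: "1 + exp ((C + u) * n j) \<le> 2 * exp ((C + u) * n j)" by simp
    have "b t * exp (C + u) \<le> b s * exp (C + u)" using s by simp
    also have "\<dots> = lam j * r1 * Q * exp (u - C * n j) / 2"
    proof -
      have "lam j * r1 * Q = 2 * b s * exp (C + C * n j)"
        unfolding Q_def times_divide_eq_right by (rule nonzero_mult_div_cancel_left) (use lr in linarith)
      moreover have "exp (C + u) = exp (C + C * n j) * exp (u - C * n j)" by (simp flip: exp_add)
      ultimately show ?thesis by simp
    qed
    also have "\<dots> < lam j * r1 * exp (u * a) * exp (u - C * n j) / 2"
      by (intro divide_strict_right_mono mult_strict_right_mono mult_strict_left_mono Q lr) auto
    also have "\<dots> = lam j * r1 * (exp (u * m j) / (2 * exp ((C + u) * n j)))"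
      by (simp add: a_def exp_add exp_diff algebra_simps)
    also have "\<dots> \<le> lam j * r1 * (exp (u * m j) / (1 + exp ((C + u) * n j)))"
      using * lr by (intro mult_left_mono divide_left_mono) (auto simp: add_pos_pos)
    also have "\<dots> \<le> lam j * r j t * (exp (u * m j) / (1 + exp ((C + u) * n j)))"
      using r1 coeff_pos(1)[OF j(1)] by (intro mult_right_mono mult_left_mono) (auto simp: add_nonneg_nonneg)
    also have "\<dots> = lam j * r j t * (exp u powr m j / (1 + exp (C + u) powr n j))"
      by (simp add: exp_powr_real)
    also have "\<dots> \<le> production j y t"
      using y by (intro production_bounds j(1)) auto
    finally show "b t * exp (C + u) < production j y t" .
  qed
qed

text \<open>The hypothesis is the third condition of the theorem. Multiplied by
  \<open>exp \<gamma>\<close>, its left side is the production bound with numerators taken at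
  \<open>exp (C + \<gamma>)\<close> and denominators at \<open>exp \<gamma>\<close>.\<close>

lemma total_production_small:
  assumes \<gamma>: "\<And>t. (\<Sum>k=1..M. lam k * r k t *
             (exp ((m k - 1) * \<gamma>) * exp (m k * C) / (1 + exp (n k * \<gamma>)))) < b t"
    and y: "\<And>t. exp \<gamma> \<le> y t" "\<And>t. y t \<le> exp (C + \<gamma>)"
  shows "(\<Sum>k=1..M. production k y t) < b t * exp \<gamma>"
proof -
  have "(\<Sum>k=1..M. production k y t) \<le> (\<Sum>k=1..M. lam k * r k t * (exp (C + \<gamma>) powr m k / (1 + exp \<gamma> powr n k)))"
    using y by (intro sum_mono production_bounds) auto
  also have "\<dots> = (\<Sum>k=1..M. lam k * r k t *
             (exp ((m k - 1) * \<gamma>) * exp (m k * C) / (1 + exp (n k * \<gamma>)))) * exp \<gamma>"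
    unfolding sum_distrib_right
  proof (rule sum.cong[OF refl])
    fix k
    have "exp (C + \<gamma>) powr m k = exp ((m k - 1) * \<gamma>) * exp (m k * C) * exp \<gamma>"
      by (simp add: exp_powr_real algebra_simps flip: exp_add)
    moreover have "exp \<gamma> powr n k = exp (n k * \<gamma>)" by (simp add: exp_powr_real mult.commute)
    ultimately show "lam k * r k t * (exp (C + \<gamma>) powr m k / (1 + exp \<gamma> powr n k)) =
        lam k * r k t * (exp ((m k - 1) * \<gamma>) * exp (m k * C) / (1 + exp (n k * \<gamma>))) * exp \<gamma>"
      by simp
  qed
  also have "\<dots> < b t * exp \<gamma>" using \<gamma> by simp
  finally show ?thesis .
qed

text \<open>The abstract existence result with \<open>L = exp \<gamma>\<close> and
  \<open>U = exp u\<close>. The term \<open>j\<close> alone supplies the positive lower bound and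
  the condition at the upper level, the other terms being nonnegative.\<close>

lemma periodic_solution:
  assumes j: "j \<in> {1..M}" "m j > n j + 1"
    and \<gamma>: "\<And>t. (\<Sum>k=1..M. lam k * r k t *
             (exp ((m k - 1) * \<gamma>) * exp (m k * C) / (1 + exp (n k * \<gamma>)))) < b t"
  obtains x where "periodic_fun_simple x T" "\<And>t. x t > 0"
    "\<And>t. (x has_real_derivative (\<Sum>k=1..M. production k x t) - b t * x t) (at t)"
proof -
  obtain u where u: "\<gamma> < u"
    "\<And>y t. \<lbrakk>\<And>t. exp u \<le> y t; \<And>t. y t \<le> exp (C + u)\<rbrakk> \<Longrightarrow> b t * exp (C + u) < production j y t"
    using production_large[OF j] by blast
  define L R where "L = exp \<gamma>" and "R = exp (C + u)"
  define F where "F y t = (\<Sum>k=1..M. production k y t)" for y t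
  have F_ge_j: "production j y t \<le> F y t" for y t
    unfolding F_def using j(1) by (intro member_le_sum production_nonneg) auto
  obtain s1 s2 where s: "\<And>t. b s1 \<le> b t" "\<And>t. b t \<le> b s2"
    using continuous_periodic_attains[OF b_cont b_per T_pos] by blast
  have "\<exists>r2. \<forall>t. r k t \<le> r2" if "k \<in> {1..M}" for k using r_bounds[OF that] by metis
  then obtain r2 where r2: "\<And>k t. k \<in> {1..M} \<Longrightarrow> r k t \<le> r2 k" by metis
  obtain r1 where r1: "0 < r1" "\<And>t. r1 \<le> r j t" using r_bounds[OF j(1)] by metis
  define c where "c = lam j * r1 * (L powr m j / (1 + R powr n j))"
  define c' where "c' = (\<Sum>k=1..M. lam k * r2 k * (R powr m k / (1 + L powr n k)))"
  have "c > 0"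
    using coeff_pos(1)[OF j(1)] r1 by (auto simp: c_def L_def add_pos_nonneg intro!: mult_pos_pos divide_pos_pos)
  have F_bounds: "c \<le> F y t \<and> F y t \<le> c'" if y: "y \<in> periodic_box T L R" for y t
  proof
    have yLR: "L \<le> y t" "y t \<le> R" for t using y by (auto simp: periodic_box_def)
    have "L > 0" by (simp add: L_def)
    have "c \<le> lam j * r j t * (L powr m j / (1 + R powr n j))"
      unfolding c_def using r1 coeff_pos(1)[OF j(1)]
      by (intro mult_right_mono mult_left_mono) (auto simp: add_nonneg_nonneg)
    also have "\<dots> \<le> production j y t" by (intro production_bounds j(1) \<open>L > 0\<close> yLR)
    finally show "c \<le> F y t" using F_ge_j[of y t] by linarith
    have "production k y t \<le> lam k * r2 k * (R powr m k / (1 + L powr n k))" if k: "k \<in> {1..M}" for k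
    proof -
      have "production k y t \<le> lam k * r k t * (R powr m k / (1 + L powr n k))"
        by (intro production_bounds k \<open>L > 0\<close> yLR)
      also have "\<dots> \<le> lam k * r2 k * (R powr m k / (1 + L powr n k))"
        using r2[OF k] coeff_pos(1)[OF k]
        by (intro mult_right_mono mult_left_mono) (auto simp: add_nonneg_nonneg)
      finally show ?thesis .
    qed
    then show "F y t \<le> c'" unfolding F_def c'_def by (intro sum_mono) auto
  qed
  obtain x where x: "x \<in> periodic_box T L R" "\<And>t. (x has_real_derivative F x t - b t * x t) (at t)"
  \<comment> \<open>Dividing by the maximum \<open>b s2\<close> and the minimum \<open>b s1\<close>
    turns the constant bounds \<open>c\<close> and \<open>c'\<close> into bounds by multiples of
    \<open>b\<close>.\<close>
  proof (rule periodic_solution_exists[of L "exp u" R "c / b s2" F "c' / b s1"])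
    show "0 < L" "L < exp u" "R = exp C * exp u" "0 < c / b s2"
      using u(1) \<open>c > 0\<close> b_pos by (auto simp: L_def R_def exp_add)
    fix y assume y: "y \<in> periodic_box T L R"
    show "continuous_on UNIV (F y)"
      unfolding F_def using y by (intro continuous_on_sum production_continuous) (auto simp: L_def)
    show "periodic_fun_simple (F y) T"
      by standard (simp add: F_def periodic_fun_simple.plus_period[OF production_periodic[OF _ y]])
    show "c / b s2 * b t \<le> F y t" for t
    proof -
      have "c / b s2 * b t \<le> c / b s2 * b s2" using s b_pos \<open>c > 0\<close> by (intro mult_left_mono) (auto simp: less_imp_le)
      then show ?thesis using F_bounds[OF y, of t] b_pos[of s2] by simp
    qed
    show "F y t \<le> c' / b s1 * b t" for t
    proof -
      have "c' \<ge> 0" using F_bounds[OF y, of 0] \<open>c > 0\<close> by linarith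
      then have "c' / b s1 * b s1 \<le> c' / b s1 * b t" using s b_pos by (intro mult_left_mono) (auto simp: less_imp_le)
      then show ?thesis using F_bounds[OF y, of t] b_pos[of s1] by simp
    qed
    show "F y t < b t * L" if "\<And>t. y t \<le> exp C * L" for t
      unfolding F_def L_def using y that
      by (intro total_production_small \<gamma>) (auto simp: periodic_box_def L_def exp_add)
    show "b t * R < F y t" if "\<And>t. exp u \<le> y t" for t
      using u(2)[of y t] that y F_ge_j[of y t] by (auto simp: periodic_box_def R_def intro: less_le_trans)
  next
    show "sup_uniformly_continuous_on (periodic_box T L R) F"
      unfolding F_def by (intro sup_uniformly_continuous_on_sum production_uniformly_continuous) (auto simp: L_def)
  qed (rule that)
  have "x t > 0" for t
    using x(1) less_le_trans[of 0 L "x t"] by (auto simp: periodic_box_def L_def)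
  with x that show ?thesis by (auto simp: periodic_box_def F_def)
qed

text \<open>As \<open>\<gamma>\<close> tends to minus infinity, terms with \<open>m k > 1\<close>
  vanish, while those with \<open>m k = 1\<close> stay below \<open>lam k * r k t * exp C\<close>.
  So the inequality of the third condition holds at every sufficiently low level.\<close>

lemma small_level_exists:
  assumes m: "\<And>k. k \<in> {1..M} \<Longrightarrow> m k \<ge> 1"
    and crit: "\<And>t. (\<Sum>k | k \<in> {1..M} \<and> m k = 1. lam k * r k t * exp C) < b t"
  obtains \<gamma> where "\<And>t. (\<Sum>k=1..M. lam k * r k t *
             (exp ((m k - 1) * \<gamma>) * exp (m k * C) / (1 + exp (n k * \<gamma>)))) < b t"
proof -
  \<comment> \<open>The gap left by the critical terms is continuous and periodic, hence bounded
    below by its positive minimum \<open>d s\<close>; this makes the choice of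
    \<open>\<gamma>\<close> uniform in \<open>t\<close>.\<close>
  define d where "d t = b t - (\<Sum>k | k \<in> {1..M} \<and> m k = 1. lam k * r k t * exp C)" for t
  have "continuous_on UNIV d"
    unfolding d_def by (intro continuous_intros b_cont r) auto
  moreover have "periodic_fun_simple d T"
    by standard (simp add: d_def periodic_fun_simple.plus_period[OF b_per] periodic_fun_simple.plus_period[OF r(3)])
  ultimately obtain s where s: "\<And>t. d s \<le> d t"
    using continuous_periodic_attains T_pos by blast
  have "d s > 0" using crit by (simp add: d_def)
  have "\<exists>r2. \<forall>t. r k t \<le> r2" if "k \<in> {1..M}" for k using r_bounds[OF that] by metis
  then obtain r2 where r2: "\<And>k t. k \<in> {1..M} \<Longrightarrow> r k t \<le> r2 k" by metis
  \<comment> \<open>A majorant of the noncritical terms that does not depend on \<open>t\<close>: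
    \<open>r k t\<close> is replaced by its bound \<open>r2 k\<close> and the denominator by
    1.\<close>
  define G where "G \<gamma> = (\<Sum>k=1..M. if m k = 1 then 0 else lam k * r2 k * (exp ((m k - 1) * \<gamma>) * exp (m k * C)))" for \<gamma>
  have "(G \<longlongrightarrow> (\<Sum>k=1..M. 0)) at_bot"
    unfolding G_def
  proof (rule tendsto_sum)
    fix k assume k: "k \<in> {1..M}"
    show "((\<lambda>\<gamma>. if m k = 1 then 0 else lam k * r2 k * (exp ((m k - 1) * \<gamma>) * exp (m k * C))) \<longlongrightarrow> 0) at_bot"
    proof (cases "m k = 1")
      case False
      then have "filterlim (\<lambda>\<gamma>. (m k - 1) * \<gamma>) at_bot at_bot"
        using m[OF k] by (intro filterlim_tendsto_pos_mult_at_bot[OF tendsto_const] filterlim_ident) auto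
      then have "((\<lambda>\<gamma>. exp ((m k - 1) * \<gamma>)) \<longlongrightarrow> 0) at_bot"
        by (rule filterlim_compose[OF exp_at_bot])
      then have "((\<lambda>\<gamma>. lam k * r2 k * (exp ((m k - 1) * \<gamma>) * exp (m k * C))) \<longlongrightarrow> lam k * r2 k * (0 * exp (m k * C))) at_bot"
        by (intro tendsto_intros)
      then show ?thesis using False by simp
    qed simp
  qed
  then have "eventually (\<lambda>\<gamma>. G \<gamma> < d s) at_bot"
    using \<open>d s > 0\<close> by (intro order_tendstoD) auto
  then obtain \<gamma> where \<gamma>: "G \<gamma> < d s" using eventually_happens trivial_limit_at_bot_linorder by blast
  have term_le: "lam k * r k t * (exp ((m k - 1) * \<gamma>) * exp (m k * C) / (1 + exp (n k * \<gamma>)))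
      \<le> (if m k = 1 then lam k * r k t * exp C else 0) +
        (if m k = 1 then 0 else lam k * r2 k * (exp ((m k - 1) * \<gamma>) * exp (m k * C)))"
    if k: "k \<in> {1..M}" for k t
  proof -
    have c: "0 \<le> lam k * r k t" using coeff_pos(1)[OF k] r(2)[OF k, of t] by simp
    have "exp ((m k - 1) * \<gamma>) * exp (m k * C) / (1 + exp (n k * \<gamma>)) \<le> exp ((m k - 1) * \<gamma>) * exp (m k * C) / 1"
      by (intro divide_left_mono) (auto simp: add_pos_pos)
    then have "lam k * r k t * (exp ((m k - 1) * \<gamma>) * exp (m k * C) / (1 + exp (n k * \<gamma>)))
        \<le> lam k * r k t * (exp ((m k - 1) * \<gamma>) * exp (m k * C))"
      using c by (intro mult_left_mono) auto
    moreover have "lam k * r k t * (exp ((m k - 1) * \<gamma>) * exp (m k * C))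
        \<le> lam k * r2 k * (exp ((m k - 1) * \<gamma>) * exp (m k * C))"
      using r2[OF k] coeff_pos(1)[OF k] by (intro mult_right_mono mult_left_mono) auto
    ultimately show ?thesis by auto
  qed
  show ?thesis
  proof (rule that)
    fix t
    have "(\<Sum>k=1..M. lam k * r k t * (exp ((m k - 1) * \<gamma>) * exp (m k * C) / (1 + exp (n k * \<gamma>))))
        \<le> (\<Sum>k=1..M. if m k = 1 then lam k * r k t * exp C else 0) + G \<gamma>"
      unfolding G_def sum.distrib[symmetric] by (intro sum_mono term_le)
    also have "(\<Sum>k=1..M. if m k = 1 then lam k * r k t * exp C else 0) =
        (\<Sum>k | k \<in> {1..M} \<and> m k = 1. lam k * r k t * exp C)"
      by (rule sum.inter_filter[symmetric]) simp
    also have "\<dots> + G \<gamma> < b t" using \<gamma> s[of t] by (simp add: d_def)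
    finally show "(\<Sum>k=1..M. lam k * r k t *
             (exp ((m k - 1) * \<gamma>) * exp (m k * C) / (1 + exp (n k * \<gamma>)))) < b t" .
  qed
qed

end

theorem theorem2p1:
  fixes T C :: real and M :: nat
    and lam m n :: "nat \<Rightarrow> real"
    and r \<tau> \<mu> :: "nat \<Rightarrow> real \<Rightarrow> real"
    and b :: "real \<Rightarrow> real"
  assumes "T > 0" and "M \<ge> 1"
    and "\<And>k. k \<in> {1..M} \<Longrightarrow> lam k > 0 \<and> m k > 0 \<and> n k > 0"
    and "\<And>k. k \<in> {1..M} \<Longrightarrow>
           continuous_on UNIV (r k) \<and> (\<forall>t. r k t > 0) \<and> periodic_fun_simple (r k) T"
    and "\<And>k. k \<in> {1..M} \<Longrightarrow>
           continuous_on UNIV (\<tau> k) \<and> (\<forall>t. \<tau> k t > 0) \<and> periodic_fun_simple (\<tau> k) T"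
    and "\<And>k. k \<in> {1..M} \<Longrightarrow>
           continuous_on UNIV (\<mu> k) \<and> (\<forall>t. \<mu> k t > 0) \<and> periodic_fun_simple (\<mu> k) T"
    and "continuous_on UNIV b \<and> (\<forall>t. b t > 0) \<and> periodic_fun_simple b T"
    and "C = integral {0..T} b"
    and "\<exists>j\<in>{1..M}. m j > n j + 1"
    and "(\<forall>k\<in>{1..M}. m k > 1)
       \<or> ((\<forall>k\<in>{1..M}. m k \<ge> 1) \<and> (\<exists>i\<in>{1..M}. m i = 1) \<and>
          (\<forall>t. (\<Sum>k | k \<in> {1..M} \<and> m k = 1. lam k * r k t * exp C) < b t))
       \<or> ((\<exists>i\<in>{1..M}. m i < 1) \<and>
          (\<exists>\<gamma>\<^sub>1::real. \<forall>t.
             (\<Sum>k=1..M. lam k * r k t *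
                (exp ((m k - 1) * \<gamma>\<^sub>1) * exp (m k * C) / (1 + exp (n k * \<gamma>\<^sub>1)))) < b t))"
  shows "\<exists>x :: real \<Rightarrow> real.
           periodic_fun_simple x T \<and> (\<forall>t. x t > 0) \<and>
           (\<forall>t. (x has_real_derivative
                  (\<Sum>k=1..M. lam k * r k t *
                     (x (t - \<tau> k t) powr m k / (1 + x (t - \<mu> k t) powr n k))) - b t * x t)
                (at t))"
proof -
  obtain B where "periodic_rate T C b B"
    using periodic_rateI[of T b C] assms(1,7,8) by metis
  then interpret periodic_rate T C b B .
  interpret delayed_production T C b B M lam m n r \<tau> \<mu>
    by (intro delayed_production.intro delayed_production_axioms.intro periodic_rate_axioms)
      (use assms(2-6) in auto)
  obtain j where j: "j \<in> {1..M}" "m j > n j + 1" using assms(9) by blast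
  obtain \<gamma> where \<gamma>: "\<And>t. (\<Sum>k=1..M. lam k * r k t *
      (exp ((m k - 1) * \<gamma>) * exp (m k * C) / (1 + exp (n k * \<gamma>)))) < b t"
  proof -
    \<comment> \<open>The first condition is merged with the second: if all \<open>m k > 1\<close>,
      the critical sum is empty and the inequality reads \<open>0 < b t\<close>.\<close>
    consider "\<forall>k\<in>{1..M}. m k \<ge> 1" "\<forall>t. (\<Sum>k | k \<in> {1..M} \<and> m k = 1. lam k * r k t * exp C) < b t"
      | "\<exists>\<gamma>. \<forall>t. (\<Sum>k=1..M. lam k * r k t *
          (exp ((m k - 1) * \<gamma>) * exp (m k * C) / (1 + exp (n k * \<gamma>)))) < b t"
    proof -
      have "(\<Sum>k | k \<in> {1..M} \<and> m k = 1. lam k * r k t * exp C) < b t" if "\<forall>k\<in>{1..M}. m k > 1" for t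
      proof -
        have "{k. k \<in> {1..M} \<and> m k = 1} = {}" using that by force
        then show ?thesis using b_pos by (simp only: sum.empty)
      qed
      then show ?thesis using assms(10) that less_imp_le by blast
    qed
    then show ?thesis
    proof cases
      case 1
      then show ?thesis using small_level_exists that by blast
    next
      case 2
      then show ?thesis using that by blast
    qed
  qed
  obtain x where "periodic_fun_simple x T" "\<And>t. x t > 0"
    "\<And>t. (x has_real_derivative (\<Sum>k=1..M. production k x t) - b t * x t) (at t)"
    by (rule periodic_solution[OF j \<gamma>]) (rule that)
  then show ?thesis
    unfolding production_def by (intro exI[of _ x] conjI allI)
qed

end
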